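(* Let $n\ge 1$, let $V$ be the $q$-analogue of the vector representation of $U_q(\mathfrak{gl}(n))$ over $\mathbb{Q}(q)$ and let $V^*$ be its dual representation. For every $r\ge 0$ let $M^r$ be the set of words of length $r$ in the alphabet $\{1,\overline 1,2,\overline 2,\dots,n,\overline n\}$, and for $w\in M^r$ let $A(w)\in\bigotimes^r(V\oplus V^* )$ be the vector obtained from the flow diagram of $w$ produced by the growth algorithm (defined in the context). Then for all $r\ge 0$ the family $\{A(w)\mid w\in M^r\}$ is a basis of $\bigotimes^r(V\oplus V^* )$.
   Context: All vector spaces are over $\mathbb{Q}(q)$. Put $\mathbf n=\{1,\dots,n\}$ and $[p]=\{1,\dots,p\}$, with $[0]=\emptyset$. **Representations.** $U_q(\mathfrak{gl}(n))$ is the usual quantised enveloping algebra with generators $E_i,F_i$ ($1\le i\le n-1$) and $K_i^{\pm1}$ ($1\le i\le n$). Its comultiplication is $\Delta(K_i)=K_i\otimes K_i$, $\Delta(E_i)=E_i\otimes K_iK_{i+1}^{-1}+1\otimes E_i$, $\Delta(F_i)=F_i\otimes 1+K_i^{-1}K_{i+1}\otimes F_i$. Its antipode is $S(K_i)=K_i^{-1}$, $S(E_i)=-E_iK_i^{-1}K_{i+1}$, $S(F_i)=-K_iK_{i+1}^{-1}F_i$. For $0\le p\le n$, $V(p)$ has basis $\{v_I: I\subseteq\mathbf n,\ |I|=p\}$, with the following action. - $E_iv_I=v_{(I\setminus\{i+1\})\cup\{i\}}$ if $i+1\in I$, $i\notin I$, and $E_iv_I=0$ otherwise. - $F_iv_I=v_{(I\setminus\{i\})\cup\{i+1\}}$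 if $i\in I$, $i+1\notin I$, and $F_iv_I=0$ otherwise. - $K_iv_I=qv_I$ if $i\in I$, and $K_iv_I=v_I$ otherwise. Put $V=V(1)$ with basis $v_1,\dots,v_n$; $V(0)$ is trivial and is identified with $\mathbb{Q}(q)$. The dual $V(p)^*$, with dual basis $v_I^*$, has action $(uf)(v)=f(S(u)v)$. **Basic maps.** For disjoint $I,J\subseteq \mathbf n$ let $\pi(I,J)=|\{(i,j)\in I\times J: i>j\}|$. - Multiplication $m_{s,t}:V(s)\otimes V(t)\to V(s+t)$ (for $s+t\le n$): $v_I\otimes v_J\mapsto(-q)^{-\pi(I,J)}v_{I\cup J}$ if $I\cap J=\emptyset$, and $0$ otherwise. - Comultiplication $\delta_{s,t}:V(s+t)\to V(s)\otimes V(t)$: $v_I\mapsto\sum(-1)^{\pi(J,K)}q^{|J||K|-\pi(J,K)}v_J\otimes v_K$, summed over $J\sqcup K=I$, $|J|=s$, $|K|=t$. - With $\kappa v_I=q^{\sum_{i\in I}(n+1-2i)}v_I$: $\mathrm{ev}_p:V(p)\otimes V(p)^*\to\mathbb{Q}(q)$, $v\otimes f\mapsto f(\kappa v)$, and $\mathrm{coev}_p:\mathbb{Q}(q)\to V(p)^*\otimes V(p)$, $1\mapsto\sum_I v_I^*\otimes\kappa^{-1}v_I$. - Transpose $m_{s,t}^*:V(s+t)^*\to V(t)^*\otimes V(s)^*$, where $g\otimes f\in V(t)^*\otimes V(s)^*$ is the functional $x\otimes y\mapsto f(x)g(y)$ on $V(s)\otimes V(t)$. **Basic triangles.** For $1\le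 a\le n$: - letter $a$: $T_a=(\mathrm{id}_V\otimes\mathrm{ev}_{a-1})\circ(\delta_{1,a-1}\otimes\mathrm{id}):V(a)\otimes V(a-1)^*\to V$, with left label $a$ and right label $a-1$; - letter $\overline a$: $T_{\overline a}=(\mathrm{ev}_{a-1}\otimes\mathrm{id}_{V^*})\circ(\mathrm{id}\otimes m_{1,a-1}^* ):V(a-1)\otimes V(a)^*\to V^*$, with left label $a-1$ and right label $a$. **Diamonds.** For $0\le x,b\le n$, the diamond with top-left label $x$ and top-right label $b$ is a map $D_{x,b}$ with target $V(x)^*\otimes V(b)$. - If $x=b$: both bottom labels are $0$ and $D_{x,b}=\mathrm{coev}_b$, with source $V(0)\otimes V(0)^*=\mathbb{Q}(q)$. - If $x\neq b$: the bottom-left label is $b$, the bottom-right label is $x$, and the source is $V(b)\otimes V(x)^*$. - If $b>x$, with $c=b-x$: $D_{x,b}=(\mathrm{id}\otimes m_{x,c})(\mathrm{coev}_x\otimes\mathrm{id}_{V(c)})(\mathrm{id}_{V(c)}\otimes\mathrm{ev}_x)(\delta_{c,x}\otimes\mathrm{id})$. - If $x>b$, with $c=x-b$: $D_{x,b}$ is $(\mathrm{ev}_b\otimes\mathrm{id})(\mathrm{id}\otimes m_{c,b}^* ):V(b)\otimes V(x)^*\to V(c)^*$ followed by $(\mathrm{id}\otimes\mathrm{id}\otimes\mathrm{ev}_c)(\mathrm{id}\otimes\delta_{b,c}\otimes\mathrm{id})(\mathrm{coev}_x\otimes\mathrm{id}):V(c)^*\to V(x)^*\otimes V(b)$. **Growth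 algorithm.** Let $w=w_1\cdots w_r$. Define labels $L(i,j),R(i,j)$ for $1\le i\le j\le r$ recursively on $j-i$. $L(i,i)$ and $R(i,i)$ are the left and right labels of the triangle of $w_i$. For $i<j$, $L(i,j)$ and $R(i,j)$ are the bottom-left and bottom-right labels of the diamond with top-left label $R(i,j-1)$ and top-right label $L(i+1,j)$. Let $$W_d=\bigotimes_{j=1}^{d-1}V(L(1,j))\otimes\bigotimes_{i=1}^{r-d+1}\bigl(V(L(i,i+d-1))\otimes V(R(i,i+d-1))^*\bigr)\otimes\bigotimes_{i=r-d+2}^{r}V(R(i,r))^*$$ with factors in increasing order of the index. For $1\le d<r$ let $W_{d+1}\to W_d$ apply, for $1\le i\le r-d$, the diamond $D_{R(i,i+d-1),L(i+1,i+d)}:V(L(i,i+d))\otimes V(R(i,i+d))^*\to V(R(i,i+d-1))^*\otimes V(L(i+1,i+d))$, and the identity on all other factors. Let $F(w)$ be the composite $W_r\to\cdots\to W_1$ followed by $T_{w_1}\otimes\cdots\otimes T_{w_r}$. Its target is the tensor product whose $i$-th factor is $V$ if $w_i$ is unbarred and $V^*$ if $w_i$ is barred, which is a direct summand of $\bigotimes^r(V\oplus V^* )$. Finally $$A(w)=F(w)\Bigl(\bigotimes_{j=1}^r v_{[L(1,j)]}\otimes\bigotimes_{i=1}^r v^*_{[R(i,r)]}\Bigr),$$ and $A$ of the empty word is $1\in\mathbb{Q}(q)$. (That is, $F(w)$ is evaluated on the highest weight vectors along the left edge of the triangle and the lowest weight vectors of the duals along the right edge.) *)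

theory Defs
  imports Complex_Main "HOL-Computational_Algebra.Computational_Algebra" "HOL-Library.Poly_Mapping"
begin

text \<open>
  Everything is over the field of rational functions \<open>\<rat>(q)\<close>.  All vector spaces are
  tensor products of spaces \<open>V(p)\<close> and \<open>V(p)\<^sup>*\<close>, each of which comes with a basis.
  A tensor product of based spaces is the free vector space on the words of basis elements
  (one letter for each factor), and all these tensor products are subspaces of the single
  free vector space \<open>tens\<close> on all words.  The empty word spans the ground field.
  A factor \<open>V(0)\<close> is kept as an explicit letter \<open>Vec {}\<close>.

  The action of \<open>U\<^sub>q(gl(n))\<close> enters neither the construction nor the assertion (which is
  about the underlying vector spaces) and is therefore not introduced.
\<close>

type_synonym ratfun = "rat poly fract"

definition q :: ratfun where
  "q = Fract [:0, 1:] 1"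

text \<open>\<open>Vec I\<close> is \<open>v\<^sub>I \<in> V(card I)\<close>, and \<open>Dual I\<close> is \<open>v\<^sub>I\<^sup>*\<close> in its dual.\<close>

datatype factor = Vec "nat set" | Dual "nat set"

type_synonym tens = "factor list \<Rightarrow>\<^sub>0 ratfun"

definition scale :: "ratfun \<Rightarrow> tens \<Rightarrow> tens" where
  "scale c x = Poly_Mapping.map ((*) c) x"

lemma lookup_scale: "Poly_Mapping.lookup (scale c x) w = c * Poly_Mapping.lookup x w"
  by (simp add: scale_def Poly_Mapping.map.rep_eq when_def)

interpretation tens: vector_space scale
  by unfold_locales
    (auto intro!: poly_mapping_eqI simp: lookup_scale lookup_add algebra_simps)

definition basis :: "factor list \<Rightarrow> tens" where
  "basis w = Poly_Mapping.single w 1"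

subsection \<open>Linear maps between tensor products\<close>

text \<open>
  A linear map out of a tensor product of \<open>k\<close> factors is given by \<open>k\<close> and by the images of
  the basis words of length \<open>k\<close>; values on words outside the intended source are irrelevant.
\<close>

datatype lmap = LMap (arity: nat) (img: "factor list \<Rightarrow> tens")

definition app :: "lmap \<Rightarrow> tens \<Rightarrow> tens" where
  "app f x = (\<Sum>w \<in> Poly_Mapping.keys x. scale (Poly_Mapping.lookup x w) (img f w))"

definition tens_mult :: "tens \<Rightarrow> tens \<Rightarrow> tens" where
  "tens_mult x y = (\<Sum>u \<in> Poly_Mapping.keys x. \<Sum>w \<in> Poly_Mapping.keys y.
     scale (Poly_Mapping.lookup x u * Poly_Mapping.lookup y w) (basis (u @ w)))"

definition comp_lmap :: "lmap \<Rightarrow> lmap \<Rightarrow> lmap"  (infixr "\<odot>" 65) where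
  "f \<odot> g = LMap (arity g) (\<lambda>w. app f (img g w))"

definition tens_lmap :: "lmap \<Rightarrow> lmap \<Rightarrow> lmap"  (infixr "\<otimes>" 70) where
  "f \<otimes> g = LMap (arity f + arity g)
     (\<lambda>w. tens_mult (img f (take (arity f) w)) (img g (drop (arity f) w)))"

definition idm :: "nat \<Rightarrow> lmap" where
  "idm k = LMap k basis"

definition big_tens :: "lmap list \<Rightarrow> lmap" where
  "big_tens fs = foldr (\<otimes>) fs (idm 0)"

subsection \<open>Basic maps\<close>

definition subsets :: "nat \<Rightarrow> nat \<Rightarrow> nat set set" where
  "subsets n p = {I. I \<subseteq> {1..n} \<and> card I = p}"

definition inversions :: "nat set \<Rightarrow> nat set \<Rightarrow> nat" where
  "inversions I J = card {(i, j). i \<in> I \<and> j \<in> J \<and> i > j}"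

definition mult :: "nat \<Rightarrow> nat \<Rightarrow> lmap" where
  "mult s t = LMap 2 (\<lambda>w. case w of
      [Vec I, Vec J] \<Rightarrow>
        (if card I = s \<and> card J = t \<and> I \<inter> J = {}
         then scale ((- q) powi (- int (inversions I J))) (basis [Vec (I \<union> J)]) else 0)
    | _ \<Rightarrow> 0)"

definition comult :: "nat \<Rightarrow> nat \<Rightarrow> lmap" where
  "comult s t = LMap 1 (\<lambda>w. case w of
      [Vec I] \<Rightarrow>
        (\<Sum>(J, K) \<in> {(J, K). J \<union> K = I \<and> J \<inter> K = {} \<and> card J = s \<and> card K = t}.
           scale ((- 1) ^ inversions J K * q powi (int (card J * card K) - int (inversions J K)))
             (basis [Vec J, Vec K]))
    | _ \<Rightarrow> 0)"

definition kappa_exp :: "nat \<Rightarrow> nat set \<Rightarrow> int" where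
  "kappa_exp n I = (\<Sum>i\<in>I. int n + 1 - 2 * int i)"

definition kappa :: "nat \<Rightarrow> nat set \<Rightarrow> tens" where
  "kappa n I = scale (q powi kappa_exp n I) (basis [Vec I])"

definition kappa_inv :: "nat \<Rightarrow> nat set \<Rightarrow> tens" where
  "kappa_inv n I = scale (q powi (- kappa_exp n I)) (basis [Vec I])"

text \<open>The value of the functional \<open>v\<^sub>J\<^sup>*\<close> at a vector.\<close>

definition dual_eval :: "nat set \<Rightarrow> tens \<Rightarrow> ratfun" where
  "dual_eval J x = Poly_Mapping.lookup x [Vec J]"

definition ev :: "nat \<Rightarrow> nat \<Rightarrow> lmap" where
  "ev n p = LMap 2 (\<lambda>w. case w of
      [Vec I, Dual J] \<Rightarrow>
        (if card I = p \<and> card J = p then scale (dual_eval J (kappa n I)) (basis []) else 0)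
    | _ \<Rightarrow> 0)"

definition coev :: "nat \<Rightarrow> nat \<Rightarrow> lmap" where
  "coev n p = LMap 0 (\<lambda>w. case w of
      [] \<Rightarrow> (\<Sum>I \<in> subsets n p. tens_mult (basis [Dual I]) (kappa_inv n I))
    | _ \<Rightarrow> 0)"

text \<open>
  The transpose of \<open>mult s t\<close>: the functional \<open>v\<^sub>K\<^sup>* \<circ> mult s t\<close> takes the value
  \<open>v\<^sub>K\<^sup>*(mult s t (v\<^sub>I \<otimes> v\<^sub>J))\<close> at \<open>v\<^sub>I \<otimes> v\<^sub>J\<close>, and the functional dual to \<open>v\<^sub>I \<otimes> v\<^sub>J\<close> is
  written \<open>v\<^sub>J\<^sup>* \<otimes> v\<^sub>I\<^sup>*\<close>, with the factors reversed.
\<close>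

definition mult_transpose :: "nat \<Rightarrow> nat \<Rightarrow> nat \<Rightarrow> lmap" where
  "mult_transpose n s t = LMap 1 (\<lambda>w. case w of
      [Dual K] \<Rightarrow>
        (\<Sum>I \<in> subsets n s. \<Sum>J \<in> subsets n t.
           scale (dual_eval K (img (mult s t) [Vec I, Vec J])) (basis [Dual J, Dual I]))
    | _ \<Rightarrow> 0)"

subsection \<open>Triangles\<close>

datatype letter = Unbarred nat | Barred nat

fun left_label :: "letter \<Rightarrow> nat" where
  "left_label (Unbarred a) = a"
| "left_label (Barred a) = a - 1"

fun right_label :: "letter \<Rightarrow> nat" where
  "right_label (Unbarred a) = a - 1"
| "right_label (Barred a) = a"

fun triangle :: "nat \<Rightarrow> letter \<Rightarrow> lmap" where
  "triangle n (Unbarred a) = (idm 1 \<otimes> ev n (a - 1)) \<odot> (comult 1 (a - 1) \<otimes> idm 1)"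
| "triangle n (Barred a) = (ev n (a - 1) \<otimes> idm 1) \<odot> (idm 1 \<otimes> mult_transpose n 1 (a - 1))"

subsection \<open>Diamonds\<close>

definition bottom_labels :: "nat \<Rightarrow> nat \<Rightarrow> nat \<times> nat" where
  "bottom_labels x b = (if x = b then (0, 0) else (b, x))"

text \<open>The identification of \<open>V(0) \<otimes> V(0)\<^sup>*\<close> with the ground field.\<close>

definition unit_iso :: lmap where
  "unit_iso = LMap 2 (\<lambda>w. if w = [Vec {}, Dual {}] then basis [] else 0)"

definition diamond :: "nat \<Rightarrow> nat \<Rightarrow> nat \<Rightarrow> lmap" where
  "diamond n x b =
    (if x = b then coev n b \<odot> unit_iso
     else if x < b then
       let c = b - x in
         (idm 1 \<otimes> mult x c) \<odot> (coev n x \<otimes> idm 1) \<odot> (idm 1 \<otimes> ev n x) \<odot> (comult c x \<otimes> idm 1)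
     else
       let c = x - b in
         (idm 1 \<otimes> idm 1 \<otimes> ev n c) \<odot> (idm 1 \<otimes> comult b c \<otimes> idm 1) \<odot> (coev n x \<otimes> idm 1)
         \<odot> (ev n b \<otimes> idm 1) \<odot> (idm 1 \<otimes> mult_transpose n c b))"

subsection \<open>Growth algorithm\<close>

text \<open>\<open>labels w i k\<close> is \<open>(L(i,i+k), R(i,i+k))\<close>; positions in \<open>w\<close> are counted from \<open>1\<close>.\<close>

fun labels :: "letter list \<Rightarrow> nat \<Rightarrow> nat \<Rightarrow> nat \<times> nat" where
  "labels w i 0 = (left_label (w ! (i - 1)), right_label (w ! (i - 1)))"
| "labels w i (Suc k) = bottom_labels (snd (labels w i k)) (fst (labels w (Suc i) k))"

definition L :: "letter list \<Rightarrow> nat \<Rightarrow> nat \<Rightarrow> nat" where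
  "L w i j = fst (labels w i (j - i))"

definition R :: "letter list \<Rightarrow> nat \<Rightarrow> nat \<Rightarrow> nat" where
  "R w i j = snd (labels w i (j - i))"

text \<open>
  The map \<open>W\<^sub>d\<^sub>+\<^sub>1 \<rightarrow> W\<^sub>d\<close>: \<open>W\<^sub>d\<^sub>+\<^sub>1\<close> has \<open>d\<close> factors \<open>V(L(1,j))\<close> to the left and \<open>d\<close> factors
  \<open>V(R(i,r))\<^sup>*\<close> to the right of the \<open>r - d\<close> pairs to which the diamonds are applied.
\<close>

definition layer :: "nat \<Rightarrow> letter list \<Rightarrow> nat \<Rightarrow> lmap" where
  "layer n w d =
     idm d
     \<otimes> big_tens (map (\<lambda>i. diamond n (R w i (i + d - 1)) (L w (i + 1) (i + d)))
                   [1..<length w - d + 1])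
     \<otimes> idm d"

definition flow :: "nat \<Rightarrow> letter list \<Rightarrow> tens \<Rightarrow> tens" where
  "flow n w = app (big_tens (map (triangle n) w))
     \<circ> foldr (\<circ>) (map (\<lambda>d. app (layer n w d)) [1..<length w]) id"

definition A :: "nat \<Rightarrow> letter list \<Rightarrow> tens" where
  "A n w =
    (if w = [] then basis []
     else flow n w (basis (map (\<lambda>j. Vec {1..L w 1 j}) [1..<length w + 1]
                         @ map (\<lambda>i. Dual {1..R w i (length w)}) [1..<length w + 1])))"

subsection \<open>Words and the target space\<close>

definition words :: "nat \<Rightarrow> nat \<Rightarrow> letter list set" where
  "words n r = {w. length w = r \<and> set w \<subseteq> Unbarred ` {1..n} \<union> Barred ` {1..n}}"

text \<open>
  The \<open>r\<close>-th tensor power of \<open>V \<oplus> V\<^sup>*\<close>, where \<open>V = V(1)\<close> has the basis \<open>Vec {1}, \<dots>, Vec {n}\<close>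
  and \<open>V\<^sup>*\<close> the basis \<open>Dual {1}, \<dots>, Dual {n}\<close>.
\<close>

definition tensor_power :: "nat \<Rightarrow> nat \<Rightarrow> tens set" where
  "tensor_power n r =
     tens.span (basis ` {u. length u = r \<and>
       set u \<subseteq> (\<lambda>i. Vec {i}) ` {1..n} \<union> (\<lambda>i. Dual {i}) ` {1..n}})"

end

theory Submission
  imports Defs
begin

text \<open>
  Order words of basis elements by dominance of the weights of all their prefixes. Every triangle
  and every diamond maps a word dominating the word of highest weight vectors \<open>v\<^bsub>[p]\<^esub>\<close> and lowest weight
  covectors \<open>v\<^sup>*\<^bsub>[p]\<^esub>\<close> of its source to a combination of words dominating the analogous word of its
  target, and the latter word arises, with nonzero coefficient, from the former only. This passes to
  tensor products and composites, so \<open>A(w)\<close> is a nonzero multiple of the basis word that has the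
  factor \<open>v\<^sub>a\<close> for each letter \<open>a\<close> and \<open>v\<^sub>a\<^sup>*\<close> for each barred \<open>a\<close>, plus words that strictly dominate it:
  the family is triangular. Only supports matter, the powers of \<open>q\<close> being nonzero.
\<close>

section \<open>Supports\<close>

abbreviation "keys \<equiv> Poly_Mapping.keys"
abbreviation "lookup \<equiv> Poly_Mapping.lookup"

lemma q_nonzero [simp]: "q \<noteq> 0"
  by (simp add: q_def Zero_fract_def eq_fract)

lemma keys_scale: "keys (scale c x) = (if c = 0 then {} else keys x)"
  by (auto simp: in_keys_iff lookup_scale)

lemma keys_basis [simp]: "keys (basis w) = {w}"
  by (simp add: basis_def)

lemma lookup_basis: "lookup (basis w) u = (if u = w then 1 else 0)"
  by (auto simp: basis_def lookup_single when_def)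

text \<open>Terms with pairwise disjoint supports cannot cancel. This allows supports to be computed
  exactly without tracking coefficients.\<close>

lemma keys_sum_disjoint:
  fixes F :: "'i \<Rightarrow> 'a \<Rightarrow>\<^sub>0 'b::comm_monoid_add"
  assumes "finite S"
    and disj: "\<And>s t y. s \<in> S \<Longrightarrow> t \<in> S \<Longrightarrow> y \<in> keys (F s) \<Longrightarrow> y \<in> keys (F t) \<Longrightarrow> s = t"
  shows "keys (sum F S) = (\<Union>s\<in>S. keys (F s))"
proof
  show "keys (sum F S) \<subseteq> (\<Union>s\<in>S. keys (F s))"
    by (rule keys_sum)
  show "(\<Union>s\<in>S. keys (F s)) \<subseteq> keys (sum F S)"
  proof
    fix y assume "y \<in> (\<Union>s\<in>S. keys (F s))"
    then obtain s where s: "s \<in> S" "y \<in> keys (F s)" by blast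
    have "lookup (sum F S) y = (\<Sum>t\<in>S. lookup (F t) y)"
      by (rule lookup_sum)
    also have "\<dots> = lookup (F s) y + (\<Sum>t\<in>S - {s}. lookup (F t) y)"
      using assms(1) s(1) by (rule sum.remove)
    also have "(\<Sum>t\<in>S - {s}. lookup (F t) y) = 0"
      using disj[OF s(1) _ s(2)] by (intro sum.neutral) (auto simp: in_keys_iff)
    finally show "y \<in> keys (sum F S)" using s(2) by (simp add: in_keys_iff)
  qed
qed

lemma keys_app_subset: "keys (app f v) \<subseteq> (\<Union>w\<in>keys v. keys (img f w))"
  unfolding app_def by (rule order_trans[OF keys_sum]) (auto simp: keys_scale split: if_splits)

text \<open>Exact counterpart of \<open>keys_app_subset\<close>: when no output word comes from two
  different input words, nothing cancels.\<close>

lemma keys_app_disjoint: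
  assumes "\<And>w z y. w \<in> keys v \<Longrightarrow> z \<in> keys v \<Longrightarrow> y \<in> keys (img f w) \<Longrightarrow> y \<in> keys (img f z) \<Longrightarrow> w = z"
  shows "keys (app f v) = (\<Union>w\<in>keys v. keys (img f w))"
  unfolding app_def
  by (subst keys_sum_disjoint) (auto simp: keys_scale in_keys_iff intro: assms)

lemma app_basis [simp]: "app f (basis w) = img f w"
  by (simp add: app_def lookup_basis)

text \<open>A common length of the left words makes the splitting of \<open>u @ w\<close> unique, so
  no two pairs contribute to the same word.\<close>

lemma keys_tens_mult:
  assumes "\<And>u. u \<in> keys a \<Longrightarrow> length u = k"
  shows "keys (tens_mult a b) = {u @ w |u w. u \<in> keys a \<and> w \<in> keys b}"
proof -
  let ?F = "\<lambda>u. \<Sum>w \<in> keys b. scale (lookup a u * lookup b w) (basis (u @ w))"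
  have F: "keys (?F u) = (\<lambda>w. u @ w) ` keys b" if "u \<in> keys a" for u
    using that by (subst keys_sum_disjoint) (auto simp: keys_scale in_keys_iff)
  show ?thesis
    unfolding tens_mult_def
  proof (subst keys_sum_disjoint)
    show "u = v" if "u \<in> keys a" "v \<in> keys a" "y \<in> keys (?F u)" "y \<in> keys (?F v)" for u v y
      using that F[OF that(1)] F[OF that(2)] assms[OF that(1)] assms[OF that(2)] by auto
  qed (auto simp: F)
qed

section \<open>Supports of the basic maps\<close>

lemma arity_simps [simp]:
  "arity (f \<otimes> g) = arity f + arity g" "arity (f \<odot> g) = arity g" "arity (idm k) = k"
  "arity (mult s t) = 2" "arity (comult s t) = 1" "arity (ev n p) = 2" "arity (coev n p) = 0"
  "arity (mult_transpose n s t) = 1" "arity unit_iso = 2"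
  by (simp_all add: tens_lmap_def comp_lmap_def idm_def mult_def comult_def ev_def coev_def
      mult_transpose_def unit_iso_def)

lemma img_comp: "img (f \<odot> g) w = app f (img g w)"
  by (simp add: comp_lmap_def)

lemma img_tens: "img (f \<otimes> g) w = tens_mult (img f (take (arity f) w)) (img g (drop (arity f) w))"
  by (simp add: tens_lmap_def)

lemma img_idm [simp]: "img (idm k) w = basis w"
  by (simp add: idm_def)

lemma keys_img_tens:
  assumes "\<And>u. u \<in> keys (img f (take (arity f) w)) \<Longrightarrow> length u = k"
  shows "keys (img (f \<otimes> g) w) =
    {u @ v |u v. u \<in> keys (img f (take (arity f) w)) \<and> v \<in> keys (img g (drop (arity f) w))}"
  unfolding img_tens using assms by (rule keys_tens_mult)

lemma keys_img_idm_tens: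
  "keys (img (idm k \<otimes> g) w) = (\<lambda>v. take k w @ v) ` keys (img g (drop k w))"
  by (subst keys_img_tens[where k = "length (take k w)"]) auto

lemma finite_subsets [simp]: "finite (subsets n p)"
  by (simp add: subsets_def)

lemma keys_mult:
  "keys (img (mult s t) [Vec I, Vec J]) =
    (if card I = s \<and> card J = t \<and> I \<inter> J = {} then {[Vec (I \<union> J)]} else {})"
  by (simp add: mult_def keys_scale)

text \<open>Since \<open>J = I - K\<close>, the summands can be indexed by \<open>K\<close> alone,
  which is the set that a later evaluation compares with a covector.\<close>

lemma keys_comult:
  assumes "finite I" "card I = s + t"
  shows "keys (img (comult s t) [Vec I]) = (\<lambda>K. [Vec (I - K), Vec K]) ` {K. K \<subseteq> I \<and> card K = t}"
proof -
  let ?S = "{(J, K). J \<union> K = I \<and> J \<inter> K = {} \<and> card J = s \<and> card K = t}"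
  let ?F = "\<lambda>(J, K). scale ((- 1) ^ inversions J K *
    q powi (int (card J * card K) - int (inversions J K))) (basis [Vec J, Vec K])"
  have img: "img (comult s t) [Vec I] = sum ?F ?S"
    by (simp add: comult_def)
  have F: "keys (?F p) = {[Vec (fst p), Vec (snd p)]}" for p
    by (cases p) (simp add: keys_scale)
  have "finite ?S"
    by (rule finite_subset[of _ "Pow I \<times> Pow I"]) (use assms in auto)
  then have "keys (img (comult s t) [Vec I]) = (\<Union>p\<in>?S. keys (?F p))"
    unfolding img by (rule keys_sum_disjoint) (auto simp only: F prod_eq_iff list.inject factor.inject singleton_iff)
  also have "\<dots> = (\<Union>p\<in>?S. {[Vec (fst p), Vec (snd p)]})"
    unfolding F ..
  also have "?S = (\<lambda>K. (I - K, K)) ` {K. K \<subseteq> I \<and> card K = t}"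
    using assms by (auto simp: image_iff card_Diff_subset finite_subset)
  finally show ?thesis by (simp add: image_image UNION_singleton_eq_range)
qed

text \<open>\<open>kappa\<close> is diagonal with powers of \<open>q\<close> as entries, so the
  twisted pairing vanishes exactly where the plain one does.\<close>

lemma keys_ev:
  "keys (img (ev n p) [Vec I, Dual J]) = (if card I = p \<and> I = J then {[]} else {})"
  by (auto simp: ev_def keys_scale dual_eval_def kappa_def lookup_scale lookup_basis)

lemma keys_coev:
  "keys (img (coev n p) []) = (\<lambda>I. [Dual I, Vec I]) ` subsets n p"
proof -
  have *: "keys (tens_mult (basis [Dual I]) (kappa_inv n I)) = {[Dual I, Vec I]}" for I
    by (subst keys_tens_mult[where k = 1]) (auto simp: kappa_inv_def keys_scale)
  have "keys (\<Sum>I\<in>subsets n p. tens_mult (basis [Dual I]) (kappa_inv n I)) =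
      (\<Union>I\<in>subsets n p. keys (tens_mult (basis [Dual I]) (kappa_inv n I)))"
    by (rule keys_sum_disjoint) (auto simp: *)
  then show ?thesis
    by (auto simp: coev_def *)
qed

lemma dual_eval_mult:
  "dual_eval K (img (mult s t) [Vec I, Vec J]) \<noteq> 0 \<longleftrightarrow>
    card I = s \<and> card J = t \<and> I \<inter> J = {} \<and> K = I \<union> J"
proof -
  have "dual_eval K (img (mult s t) [Vec I, Vec J]) \<noteq> 0 \<longleftrightarrow>
      [Vec K] \<in> keys (img (mult s t) [Vec I, Vec J])"
    by (simp add: dual_eval_def in_keys_iff)
  then show ?thesis by (auto simp: keys_mult)
qed

text \<open>Each word comes from exactly one splitting of \<open>K\<close> into two disjoint parts,
  and \<open>K \<subseteq> {1..n}\<close> ensures that both parts occur in the double sum.\<close>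

lemma keys_mult_transpose:
  assumes "K \<subseteq> {1..n}" "card K = s + t"
  shows "keys (img (mult_transpose n s t) [Dual K]) = (\<lambda>J. [Dual J, Dual (K - J)]) ` {J. J \<subseteq> K \<and> card J = t}"
proof -
  have fin: "finite K" using assms(1) finite_subset by blast
  let ?F = "\<lambda>I J. scale (dual_eval K (img (mult s t) [Vec I, Vec J])) (basis [Dual J, Dual I])"
  have F: "keys (?F I J) = (if card I = s \<and> card J = t \<and> I \<inter> J = {} \<and> K = I \<union> J
      then {[Dual J, Dual I]} else {})" for I J
    using dual_eval_mult[of K s t I J] by (auto simp: keys_scale)
  have G: "keys (\<Sum>J\<in>subsets n t. ?F I J) = (\<Union>J\<in>subsets n t. keys (?F I J))" for I
    by (rule keys_sum_disjoint) (auto simp: F split: if_splits)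
  have "keys (img (mult_transpose n s t) [Dual K]) = keys (\<Sum>I\<in>subsets n s. \<Sum>J\<in>subsets n t. ?F I J)"
    by (simp add: mult_transpose_def)
  also have "\<dots> = (\<Union>I\<in>subsets n s. keys (\<Sum>J\<in>subsets n t. ?F I J))"
    by (rule keys_sum_disjoint) (simp, unfold G F, auto split: if_splits)
  also have "\<dots> = (\<Union>I\<in>subsets n s. \<Union>J\<in>subsets n t. keys (?F I J))"
    unfolding G ..
  also have "\<dots> = (\<lambda>(I, J). [Dual J, Dual I]) `
      {(I, J). card I = s \<and> card J = t \<and> I \<inter> J = {} \<and> K = I \<union> J}"
    unfolding F using assms(1) by (auto simp: subsets_def image_iff split: if_splits)
  also have "{(I, J). card I = s \<and> card J = t \<and> I \<inter> J = {} \<and> K = I \<union> J} =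
      (\<lambda>J. (K - J, J)) ` {J. J \<subseteq> K \<and> card J = t}"
    using assms(2) fin by (auto simp: image_iff card_Diff_subset finite_subset)
  finally show ?thesis by (simp add: image_image)
qed

section \<open>Triangles and diamonds\<close>

lemma keys_comp_empty:
  "keys (img g w) = {} \<Longrightarrow> keys (img (f \<odot> g) w) = {}"
  by (simp add: img_comp app_def)

lemma keys_comp_single:
  "keys (img g w) = {u} \<Longrightarrow> keys (img (f \<odot> g) w) = keys (img f u)"
  unfolding img_comp by (subst keys_app_disjoint) auto

text \<open>\<open>S\<close> indexes the words produced by \<open>g\<close>, and \<open>T k\<close>
  those that \<open>f\<close> makes of the \<open>k\<close>-th one. By the last hypothesis an output
  word determines \<open>k\<close>, so contributions of different \<open>k\<close> do not
  cancel.\<close>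

lemma keys_comp_Sigma:
  assumes "keys (img g w) = e ` S" "\<And>k. k \<in> S \<Longrightarrow> keys (img f (e k)) = d k ` T k"
    and "\<And>k l i j. k \<in> S \<Longrightarrow> l \<in> S \<Longrightarrow> i \<in> T k \<Longrightarrow> j \<in> T l \<Longrightarrow> d k i = d l j \<Longrightarrow> k = l"
  shows "keys (img (f \<odot> g) w) = (\<lambda>(k, j). d k j) ` Sigma S T"
proof -
  have "keys (img (f \<odot> g) w) = (\<Union>k\<in>S. keys (img f (e k)))"
    unfolding img_comp
    by (subst keys_app_disjoint) (auto simp: assms(1,2) dest: assms(3))
  also have "\<dots> = (\<lambda>(k, j). d k j) ` Sigma S T"
    by (auto simp: assms(2))
  finally show ?thesis .
qed

text \<open>For maps such as evaluations and products, which either kill a basis word or send it to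
  a multiple of a single word.\<close>

lemma keys_comp_filter:
  assumes "keys (img g w) = e ` S"
    and "\<And>k. k \<in> S \<Longrightarrow> keys (img f (e k)) = (if P k then {d k} else {})"
    and "\<And>k l. k \<in> S \<Longrightarrow> l \<in> S \<Longrightarrow> P k \<Longrightarrow> P l \<Longrightarrow> d k = d l \<Longrightarrow> k = l"
  shows "keys (img (f \<odot> g) w) = d ` {k \<in> S. P k}"
proof -
  \<comment> \<open>The condition \<open>P\<close> is encoded as an index set with at most one
    element.\<close>
  have "keys (img (f \<odot> g) w) = (\<lambda>(k, j). d k) ` Sigma S (\<lambda>k. if P k then {()} else {})"
    by (rule keys_comp_Sigma[OF assms(1)]) (auto simp: assms(2) split: if_splits intro: assms(3))
  also have "\<dots> = d ` {k \<in> S. P k}"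
    by (force split: if_splits)
  finally show ?thesis .
qed

lemma keys_comult_tens_idm:
  assumes "finite I" "card I = s + t"
  shows "keys (img (comult s t \<otimes> idm k) (Vec I # w)) =
    (\<lambda>K. Vec (I - K) # Vec K # w) ` {K. K \<subseteq> I \<and> card K = t}"
  by (subst keys_img_tens[where k = 2]) (auto simp: keys_comult[OF assms])

lemma keys_ev_tens_idm:
  "keys (img (ev n p \<otimes> idm k) (Vec I # Dual J # w)) = (if card I = p \<and> I = J then {w} else {})"
  by (subst keys_img_tens[where k = 0]) (auto simp: keys_ev split: if_splits)

lemma keys_coev_tens_idm:
  "keys (img (coev n p \<otimes> idm k) w) = (\<lambda>I. Dual I # Vec I # w) ` subsets n p"
  by (subst keys_img_tens[where k = 2]) (auto simp: keys_coev)

text \<open>Evaluation retains only the summand \<open>K = J\<close> of the comultiplication. The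
  case \<open>s = 1\<close> is the unbarred triangle, the case \<open>s = b - x\<close> the first
  half of a diamond with \<open>x < b\<close>.\<close>

lemma keys_ev_comult:
  assumes "finite I" "card I = s + t" "card J = t"
  shows "keys (img ((idm 1 \<otimes> ev n t) \<odot> (comult s t \<otimes> idm 1)) [Vec I, Dual J]) =
    (if J \<subseteq> I then {[Vec (I - J)]} else {})"
proof -
  have "keys (img ((idm 1 \<otimes> ev n t) \<odot> (comult s t \<otimes> idm 1)) [Vec I, Dual J]) =
      (\<lambda>K. [Vec (I - K)]) ` {K \<in> {K. K \<subseteq> I \<and> card K = t}. K = J}"
    by (rule keys_comp_filter[OF keys_comult_tens_idm[OF assms(1,2)]])
      (auto simp: keys_img_idm_tens keys_ev)
  also have "{K \<in> {K. K \<subseteq> I \<and> card K = t}. K = J} = (if J \<subseteq> I then {J} else {})"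
    using assms(3) by auto
  finally show ?thesis by simp
qed

text \<open>Dual to \<open>keys_ev_comult\<close>, again because only \<open>K = J\<close> survives.
  It covers the barred triangle and the first half of a diamond with \<open>b < x\<close>.\<close>

lemma keys_ev_mult_transpose:
  assumes "I \<subseteq> {1..n}" "card I = s + t" "card J = t"
  shows "keys (img ((ev n t \<otimes> idm 1) \<odot> (idm 1 \<otimes> mult_transpose n s t)) [Vec J, Dual I]) =
    (if J \<subseteq> I then {[Dual (I - J)]} else {})"
proof -
  have 1: "keys (img (idm 1 \<otimes> mult_transpose n s t) [Vec J, Dual I]) =
      (\<lambda>K. [Vec J, Dual K, Dual (I - K)]) ` {K. K \<subseteq> I \<and> card K = t}"
    by (simp add: keys_img_idm_tens keys_mult_transpose[OF assms(1,2)] image_image)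
  have "keys (img ((ev n t \<otimes> idm 1) \<odot> (idm 1 \<otimes> mult_transpose n s t)) [Vec J, Dual I]) =
      (\<lambda>K. [Dual (I - K)]) ` {K \<in> {K. K \<subseteq> I \<and> card K = t}. K = J}"
    by (rule keys_comp_filter[OF 1]) (auto simp: keys_ev_tens_idm)
  also have "{K \<in> {K. K \<subseteq> I \<and> card K = t}. K = J} = (if J \<subseteq> I then {J} else {})"
    using assms(3) by auto
  finally show ?thesis by simp
qed

section \<open>Supports of triangles and diamonds\<close>

lemma keys_triangle_unbarred:
  assumes "finite I" "card I = a" "1 \<le> a" "card J = a - 1"
  shows "keys (img (triangle n (Unbarred a)) [Vec I, Dual J]) = (if J \<subseteq> I then {[Vec (I - J)]} else {})"
  unfolding triangle.simps by (rule keys_ev_comult) (use assms in auto)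

lemma keys_triangle_barred:
  assumes "I \<subseteq> {1..n}" "card I = a" "1 \<le> a" "card J = a - 1"
  shows "keys (img (triangle n (Barred a)) [Vec J, Dual I]) = (if J \<subseteq> I then {[Dual (I - J)]} else {})"
  unfolding triangle.simps by (rule keys_ev_mult_transpose) (use assms in auto)

lemma keys_diamond_eq:
  "keys (img (diamond n b b) [Vec {}, Dual {}]) = (\<lambda>I. [Dual I, Vec I]) ` subsets n b"
  by (simp add: diamond_def img_comp unit_iso_def keys_coev)

text \<open>The diamond factors through V(b - x), where only the vector of \<open>B - X\<close> is
  left, or nothing. Coevaluation then inserts every \<open>Y\<close>, and multiplication retains
  those disjoint from \<open>B - X\<close>.\<close>

lemma keys_diamond_less:
  assumes "x < b" "finite B" "card B = b" "card X = x"
  shows "keys (img (diamond n x b) [Vec B, Dual X]) = (if X \<subseteq> B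
    then (\<lambda>Y. [Dual Y, Vec (Y \<union> (B - X))]) ` {Y \<in> subsets n x. Y \<inter> (B - X) = {}} else {})"
proof -
  define c where "c = b - x"
  have cx: "card B = c + x" using assms by (simp add: c_def)
  have diamond: "diamond n x b =
      (idm 1 \<otimes> mult x c) \<odot> (coev n x \<otimes> idm 1) \<odot> (idm 1 \<otimes> ev n x) \<odot> (comult c x \<otimes> idm 1)"
    using assms by (simp add: diamond_def c_def Let_def)
  note 1 = keys_ev_comult[OF assms(2) cx assms(4), of n]
  show ?thesis
  proof (cases "X \<subseteq> B")
    case True
    then have card: "card (B - X) = c"
      using assms by (simp add: c_def card_Diff_subset finite_subset)
    have "keys (img ((coev n x \<otimes> idm 1) \<odot> (idm 1 \<otimes> ev n x) \<odot> (comult c x \<otimes> idm 1)) [Vec B, Dual X]) =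
        (\<lambda>Y. [Dual Y, Vec Y, Vec (B - X)]) ` subsets n x"
      using True 1 by (subst keys_comp_single) (simp_all add: keys_coev_tens_idm)
    then show ?thesis
      unfolding diamond if_P[OF True]
      by (rule keys_comp_filter) (auto simp: keys_img_idm_tens keys_mult card subsets_def)
  qed (use 1 in \<open>simp add: diamond keys_comp_empty\<close>)
qed

text \<open>The diamond factors through the dual of V(x - b), where only the covector of
  \<open>C = X - B\<close> is left, or nothing. Coevaluation then inserts every \<open>Y\<close>,
  comultiplication splits it into \<open>Y - K\<close> and \<open>K\<close>, and the final
  evaluation forces \<open>K = C\<close>.\<close>

lemma keys_diamond_greater:
  assumes "b < x" "X \<subseteq> {1..n}" "card B = b" "card X = x"
  shows "keys (img (diamond n x b) [Vec B, Dual X]) = (if B \<subseteq> X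
    then (\<lambda>Y. [Dual Y, Vec (Y - (X - B))]) ` {Y \<in> subsets n x. X - B \<subseteq> Y} else {})"
proof -
  define c where "c = x - b"
  have cb: "card X = c + b" using assms by (simp add: c_def)
  have fin: "finite X" using assms(2) finite_subset by blast
  have diamond: "diamond n x b = (idm 1 \<otimes> idm 1 \<otimes> ev n c) \<odot> (idm 1 \<otimes> comult b c \<otimes> idm 1) \<odot> (coev n x \<otimes> idm 1)
         \<odot> (ev n b \<otimes> idm 1) \<odot> (idm 1 \<otimes> mult_transpose n c b)"
    using assms by (simp add: diamond_def c_def Let_def)
  note 1 = keys_ev_mult_transpose[OF assms(2) cb assms(3)]
  show ?thesis
  proof (cases "B \<subseteq> X")
    case True
    define C where "C = X - B"
    have card: "card C = c"
      using assms fin True by (simp add: C_def c_def card_Diff_subset finite_subset)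
    define T where "T = (\<lambda>Y :: nat set. {K. K \<subseteq> Y \<and> card K = c})"
    have 2: "keys (img ((coev n x \<otimes> idm 1) \<odot> (ev n b \<otimes> idm 1) \<odot> (idm 1 \<otimes> mult_transpose n c b)) [Vec B, Dual X]) =
        (\<lambda>Y. [Dual Y, Vec Y, Dual C]) ` subsets n x"
      using True 1 by (subst keys_comp_single) (simp_all add: keys_coev_tens_idm C_def)
    have 3: "keys (img (idm 1 \<otimes> comult b c \<otimes> idm 1) [Dual Y, Vec Y, Dual C]) =
        (\<lambda>K. [Dual Y, Vec (Y - K), Vec K, Dual C]) ` T Y" if "Y \<in> subsets n x" for Y
    proof -
      have "finite Y" "card Y = b + c"
        using that assms(1) finite_subset by (auto simp: subsets_def c_def)
      then show ?thesis
        by (simp add: keys_img_idm_tens keys_comult_tens_idm image_image T_def)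
    qed
    have 4: "keys (img ((idm 1 \<otimes> comult b c \<otimes> idm 1) \<odot> (coev n x \<otimes> idm 1) \<odot> (ev n b \<otimes> idm 1)
          \<odot> (idm 1 \<otimes> mult_transpose n c b)) [Vec B, Dual X]) =
        (\<lambda>(Y, K). [Dual Y, Vec (Y - K), Vec K, Dual C]) ` Sigma (subsets n x) T"
      by (rule keys_comp_Sigma[OF 2 3]) auto
    have 5: "keys (img (idm 1 \<otimes> idm 1 \<otimes> ev n c) [Dual Y, Vec M, Vec K, Dual C]) =
        (if K = C then {[Dual Y, Vec M]} else {})" for Y M K
      using card by (simp add: keys_img_idm_tens keys_ev)
    have "keys (img (diamond n x b) [Vec B, Dual X]) =
        (\<lambda>p. [Dual (fst p), Vec (fst p - snd p)]) ` {p \<in> Sigma (subsets n x) T. snd p = C}"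
      unfolding diamond
      by (rule keys_comp_filter[OF 4]) (auto simp only: split_beta 5 prod_eq_iff fst_conv snd_conv
          list.inject factor.inject mem_Sigma_iff)
    also have "{p \<in> Sigma (subsets n x) T. snd p = C} = (\<lambda>Y. (Y, C)) ` {Y \<in> subsets n x. C \<subseteq> Y}"
      by (auto simp: T_def card)
    finally show ?thesis
      by (simp add: image_image True C_def)
  qed (use 1 in \<open>simp add: diamond keys_comp_empty\<close>)
qed

section \<open>Dominance\<close>

fun prefix_card :: "factor \<Rightarrow> nat \<Rightarrow> int" where
  "prefix_card (Vec I) m = int (card (I \<inter> {1..m}))"
| "prefix_card (Dual I) m = - int (card (I \<inter> {1..m}))"

text \<open>
  Partial sums of the weight of a word: writing the \<open>gl\<^sub>n\<close>-weight as \<open>(\<lambda>\<^sub>1, \<dots>, \<lambda>\<^sub>n)\<close>, the value at \<open>m\<close>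
  is \<open>\<lambda>\<^sub>1 + \<dots> + \<lambda>\<^sub>m\<close>, so that dominance of weights is the pointwise order.
\<close>

definition weight :: "factor list \<Rightarrow> nat \<Rightarrow> int" where
  "weight s m = (\<Sum>a\<leftarrow>s. prefix_card a m)"

lemma weight_simps [simp]:
  "weight [] m = 0" "weight (a # s) m = prefix_card a m + weight s m"
  "weight (s @ t) m = weight s m + weight t m"
  by (simp_all add: weight_def)

text \<open>Only the first argument is confined to \<open>{1..n}\<close>, so that
  \<open>same_kind n a a\<close> expresses that \<open>a\<close> is a basis element of some V(p) or
  of its dual.\<close>

fun same_kind :: "nat \<Rightarrow> factor \<Rightarrow> factor \<Rightarrow> bool" where
  "same_kind n (Vec I) (Vec J) \<longleftrightarrow> I \<subseteq> {1..n} \<and> card I = card J"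
| "same_kind n (Dual I) (Dual J) \<longleftrightarrow> I \<subseteq> {1..n} \<and> card I = card J"
| "same_kind n _ _ \<longleftrightarrow> False"

text \<open>
  Every prefix of \<open>x\<close>, shifted by \<open>h\<close>, has weight at least that of the prefix of \<open>s\<close> of the same
  length. The shift accounts for what precedes \<open>x\<close> and \<open>s\<close> in a tensor product.
\<close>

fun dominates :: "nat \<Rightarrow> (nat \<Rightarrow> int) \<Rightarrow> factor list \<Rightarrow> factor list \<Rightarrow> bool" where
  "dominates n h [] [] \<longleftrightarrow> (\<forall>m. 0 \<le> h m)"
| "dominates n h (a # x) (b # s) \<longleftrightarrow> (\<forall>m. 0 \<le> h m) \<and> same_kind n a b \<and>
     dominates n (\<lambda>m. h m + prefix_card a m - prefix_card b m) x s"
| "dominates n h _ _ \<longleftrightarrow> False"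

lemma dominates_length: "dominates n h x s \<Longrightarrow> length x = length s"
  by (induction n h x s rule: dominates.induct) auto

lemma dominates_shift_nonneg: "dominates n h x s \<Longrightarrow> 0 \<le> h m"
  by (induction n h x s rule: dominates.induct) auto

lemma dominates_append:
  "length x = length s \<Longrightarrow> dominates n h (x @ y) (s @ t) \<longleftrightarrow>
     dominates n h x s \<and> dominates n (\<lambda>m. h m + weight x m - weight s m) y t"
proof (induction n h x s rule: dominates.induct)
  case (1 n h)
  then show ?case using dominates_shift_nonneg by auto
qed (auto simp: algebra_simps)

lemma dominates_append_right:
  assumes "dominates n h z (s @ t)"
  obtains x y where "z = x @ y" "length x = length s" "dominates n h x s"
    "dominates n (\<lambda>m. h m + weight x m - weight s m) y t"
proof
  let ?x = "take (length s) z" and ?y = "drop (length s) z"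
  have "length ?x = length s" using dominates_length[OF assms] by simp
  with assms show "z = ?x @ ?y" "length ?x = length s" "dominates n h ?x s"
    "dominates n (\<lambda>m. h m + weight ?x m - weight s m) ?y t"
    using dominates_append[of ?x s n h ?y t] by auto
qed

section \<open>Dominance is a partial order\<close>

lemma prefix_card_eqI:
  assumes "\<And>m. card (I \<inter> {1..m}) = card (J \<inter> {1..m})" "(0::nat) \<notin> I" "0 \<notin> J"
  shows "I = J"
proof -
  \<comment> \<open>The elements of a set are the places where its counting function jumps.\<close>
  have *: "m \<in> K \<longleftrightarrow> card (K \<inter> {1..m}) \<noteq> card (K \<inter> {1..m - 1})" if "m \<ge> 1" for K :: "nat set" and m
  proof -
    have "{1..m} = insert m {1..m - 1}" using that by auto
    then show ?thesis using that by (simp add: Int_insert_right)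
  qed
  have "m \<in> I \<longleftrightarrow> m \<in> J" for m
    by (cases "m \<ge> 1") (use *[of m] assms in \<open>auto simp: not_le\<close>)
  then show ?thesis by blast
qed

text \<open>The count is bounded by both \<open>card I\<close> and \<open>m\<close>, and the initial
  segment attains the smaller bound. This is why [p] has the highest weight in V(p).\<close>

lemma card_Int_atMost_standard:
  assumes "I \<subseteq> {1..n}"
  shows "card (I \<inter> {1..m}) \<le> card ({1..card I} \<inter> {1..m})"
proof -
  have "finite I" using assms finite_subset by blast
  then have "card (I \<inter> {1..m}) \<le> card I" by (intro card_mono) auto
  moreover have "card (I \<inter> {1..m}) \<le> card {1..m}" by (intro card_mono) auto
  moreover have "{1..card I} \<inter> {1..m} = {1..min (card I) m}" by auto
  ultimately show ?thesis by simp
qed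

lemma same_kind_eqI:
  assumes "same_kind n a b" "same_kind n b a" "\<And>m. prefix_card a m = prefix_card b m"
  shows "a = b"
proof -
  have "I = J" if "I \<subseteq> {1..n}" "J \<subseteq> {1..n}" "\<And>m. card (I \<inter> {1..m}) = card (J \<inter> {1..m})" for I J
    using that by (intro prefix_card_eqI) auto
  with assms show ?thesis
    by (cases a; cases b) auto
qed

text \<open>The reverse comparison carries the opposite shift. Both shifts being nonnegative, they
  vanish before and after each letter, so corresponding letters have equal counts and hence
  agree.\<close>

lemma dominates_antisym_aux:
  assumes "dominates n h x s" "dominates n (\<lambda>m. - h m) s x"
  shows "x = s"
  using assms
proof (induction n h x s rule: dominates.induct)
  case (2 n h a x b s)
  from "2.prems" have h: "h m = 0" for m by (auto intro: order.antisym)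
  from "2.prems" have 1: "dominates n (\<lambda>m. prefix_card a m - prefix_card b m) x s"
    "dominates n (\<lambda>m. prefix_card b m - prefix_card a m) s x" by (simp_all add: h)
  have "prefix_card a m = prefix_card b m" for m
    using dominates_shift_nonneg[OF 1(1), of m] dominates_shift_nonneg[OF 1(2), of m] by simp
  then have "a = b" using 2 same_kind_eqI by auto
  moreover have "x = s"
    using "2.IH" 1 by (simp add: h)
  ultimately show ?case by simp
qed auto

lemma dominates_antisym:
  "dominates n (\<lambda>_. 0) x s \<Longrightarrow> dominates n (\<lambda>_. 0) s x \<Longrightarrow> x = s"
  using dominates_antisym_aux[of n "\<lambda>_. 0"] by simp

lemma same_kind_trans: "same_kind n a b \<Longrightarrow> same_kind n b c \<Longrightarrow> same_kind n a c"
  by (cases a; cases b; cases c) auto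

text \<open>The shifts of the two comparisons add up, so the induction has to run over arbitrary
  shifts.\<close>

lemma dominates_trans_aux:
  "dominates n h x y \<Longrightarrow> dominates n k y z \<Longrightarrow> dominates n (\<lambda>m. h m + k m) x z"
proof (induction n h x y arbitrary: k z rule: dominates.induct)
  case (2 n h a x b s)
  then obtain c t where z: "z = c # t" by (cases z) auto
  have "dominates n (\<lambda>m. (h m + prefix_card a m - prefix_card b m) + (k m + prefix_card b m - prefix_card c m)) x t"
    by (rule "2.IH") (use "2.prems" z in auto)
  then have "dominates n (\<lambda>m. h m + k m + prefix_card a m - prefix_card c m) x t"
    by (simp add: algebra_simps)
  with 2 z show ?case by (auto intro: same_kind_trans)
next
  case (1 n h)
  then show ?case by (cases z) auto
qed auto

lemma dominates_trans:
  "dominates n (\<lambda>_. 0) x y \<Longrightarrow> dominates n (\<lambda>_. 0) y z \<Longrightarrow> dominates n (\<lambda>_. 0) x z"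
  using dominates_trans_aux[of n "\<lambda>_. 0" x y "\<lambda>_. 0"] by simp

lemma dominates_refl:
  assumes "\<And>a. a \<in> set s \<Longrightarrow> same_kind n a a"
  shows "dominates n (\<lambda>_. 0) s s"
  using assms by (induction s) auto

section \<open>Leading words of linear maps\<close>

text \<open>
  Maps with this property turn a vector supported on words dominating \<open>s\<close>, with \<open>s\<close> itself
  occurring, into one of the same kind for \<open>t\<close>. The shift \<open>h\<close> makes the notion stable under
  tensor products.
\<close>

definition leading :: "nat \<Rightarrow> lmap \<Rightarrow> factor list \<Rightarrow> factor list \<Rightarrow> bool" where
  "leading n f s t \<longleftrightarrow> length s = arity f \<and> dominates n (\<lambda>_. 0) s s \<and> weight t = weight s \<and> t \<in> keys (img f s) \<and>
     (\<forall>h x y. dominates n h x s \<longrightarrow> y \<in> keys (img f x) \<longrightarrow>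
        dominates n h y t \<and> weight y = weight x \<and> (h = (\<lambda>_. 0) \<longrightarrow> y = t \<longrightarrow> x = s))"

lemma leading_idm: "length s = k \<Longrightarrow> dominates n (\<lambda>_. 0) s s \<Longrightarrow> leading n (idm k) s s"
  by (auto simp: leading_def)

text \<open>The right factor sees the shift \<open>h\<close> corrected by the weight difference of
  the left parts. This correction is the same before and after applying \<open>f\<close>, because
  \<open>f\<close> preserves weights; hence the condition for \<open>g\<close> applies with that
  shift.\<close>

lemma leading_tens:
  assumes f: "leading n f s t" and g: "leading n g s' t'"
  shows "leading n (f \<otimes> g) (s @ s') (t @ t')"
proof -
  have s: "length s = arity f" "dominates n (\<lambda>_. 0) s s" "weight t = weight s" "t \<in> keys (img f s)"
    and s': "length s' = arity g" "dominates n (\<lambda>_. 0) s' s'" "weight t' = weight s'" "t' \<in> keys (img g s')"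
    using f g by (auto simp: leading_def)
  have f_keys: "dominates n h u t" "weight u = weight x" "h = (\<lambda>_. 0) \<Longrightarrow> u = t \<Longrightarrow> x = s"
    if "dominates n h x s" "u \<in> keys (img f x)" for h x u
    using f that unfolding leading_def by blast+
  have g_keys: "dominates n h u t'" "weight u = weight x" "h = (\<lambda>_. 0) \<Longrightarrow> u = t' \<Longrightarrow> x = s'"
    if "dominates n h x s'" "u \<in> keys (img g x)" for h x u
    using g that unfolding leading_def by blast+
  have keys: "keys (img (f \<otimes> g) (x @ x')) = {u @ v |u v. u \<in> keys (img f x) \<and> v \<in> keys (img g x')}"
    if "dominates n h x s" for x x' h
  proof -
    have "length x = arity f" using that s(1) dominates_length by auto
    then show ?thesis
      using dominates_length[OF f_keys(1)[OF that]] by (subst keys_img_tens) auto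
  qed
  have "dominates n h y (t @ t') \<and> weight y = weight z \<and> (h = (\<lambda>_. 0) \<longrightarrow> y = t @ t' \<longrightarrow> z = s @ s')"
    if z: "dominates n h z (s @ s')" and y: "y \<in> keys (img (f \<otimes> g) z)" for h z y
  proof -
    from z obtain x x' where x: "z = x @ x'" "length x = length s" "dominates n h x s"
      "dominates n (\<lambda>m. h m + weight x m - weight s m) x' s'" by (rule dominates_append_right)
    from y x keys[OF x(3)] obtain u v where uv: "y = u @ v" "u \<in> keys (img f x)" "v \<in> keys (img g x')"
      by auto
    note u = f_keys[OF x(3) uv(2)] and v = g_keys[OF x(4) uv(3)]
    have len: "length u = length t" using dominates_length[OF u(1)] .
    have "dominates n h y (t @ t')"
      unfolding uv(1) using u v s(3) len by (simp add: dominates_append)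
    moreover have "weight y = weight z"
      unfolding uv(1) x(1) by (rule ext) (simp add: u(2) v(2))
    moreover have "z = s @ s'" if h: "h = (\<lambda>_. 0)" and eq: "y = t @ t'"
    proof -
      have "u = t" "v = t'" using eq uv(1) len by auto
      \<comment> \<open>Once \<open>x = s\<close>, the shift seen by \<open>g\<close> vanishes as
        well, and the uniqueness clause of \<open>g\<close> becomes available.\<close>
      with u h have "x = s" by blast
      with v h \<open>v = t'\<close> show ?thesis by (simp add: x(1))
    qed
    ultimately show ?thesis by blast
  qed
  moreover have "t @ t' \<in> keys (img (f \<otimes> g) (s @ s'))"
    using keys[OF s(2)] s(4) s'(4) by blast
  moreover have "dominates n (\<lambda>_. 0) (s @ s') (s @ s')"
    using s s' by (simp add: dominates_append)
  moreover have "weight (t @ t') = weight (s @ s')"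
    using s(3) s'(3) by (intro ext) simp
  ultimately show ?thesis
    unfolding leading_def using s(1) s'(1) by auto
qed

lemma leading_big_tens:
  assumes "list_all2 (\<lambda>f (s, t). leading n f s t) fs sts"
  shows "leading n (big_tens fs) (concat (map fst sts)) (concat (map snd sts))"
  using assms
proof (induction rule: list_all2_induct)
  case Nil
  then show ?case by (simp add: big_tens_def leading_idm)
next
  case (Cons f fs p sts)
  then show ?case by (cases p) (simp add: big_tens_def leading_tens)
qed

text \<open>The leading word is the smallest word of the support in the dominance order, not the
  largest.\<close>

definition led_by :: "nat \<Rightarrow> tens \<Rightarrow> factor list \<Rightarrow> bool" where
  "led_by n v s \<longleftrightarrow> s \<in> keys v \<and> (\<forall>x\<in>keys v. dominates n (\<lambda>_. 0) x s)"

lemma led_by_basis: "dominates n (\<lambda>_. 0) s s \<Longrightarrow> led_by n (basis s) s"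
  by (simp add: led_by_def)

text \<open>By the uniqueness clause of \<open>leading\<close>, the coefficient of \<open>t\<close>
  receives a contribution from \<open>s\<close> alone. It is a product of two nonzero
  factors.\<close>

lemma led_by_app:
  assumes "leading n f s t" "led_by n v s"
  shows "led_by n (app f v) t"
proof -
  have f: "dominates n (\<lambda>_. 0) y t" "y = t \<Longrightarrow> x = s"
    if "x \<in> keys v" "y \<in> keys (img f x)" for x y
    using assms that unfolding leading_def led_by_def by blast+
  have s: "s \<in> keys v" "t \<in> keys (img f s)"
    using assms by (auto simp: leading_def led_by_def)
  have "lookup (app f v) t = (\<Sum>x\<in>keys v. lookup v x * lookup (img f x) t)"
    by (simp add: app_def lookup_sum lookup_scale)
  also have "\<dots> = (\<Sum>x\<in>{s}. lookup v x * lookup (img f x) t)"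
  proof (rule sum.mono_neutral_right)
    show "\<forall>x\<in>keys v - {s}. lookup v x * lookup (img f x) t = 0"
      using f(2)[of _ t] by (auto simp: in_keys_iff)
  qed (use s in auto)
  also have "\<dots> \<noteq> 0"
    using s by (simp add: in_keys_iff)
  finally have "t \<in> keys (app f v)" by (simp add: in_keys_iff)
  then show ?thesis
    using keys_app_subset[of f v] f(1) by (force simp: led_by_def)
qed

section \<open>Leading words of triangles and diamonds\<close>

lemma prefix_card_Vec_Un:
  "finite I \<Longrightarrow> finite J \<Longrightarrow> I \<inter> J = {} \<Longrightarrow>
    prefix_card (Vec (I \<union> J)) m = prefix_card (Vec I) m + prefix_card (Vec J) m"
  by (simp add: Int_Un_distrib2) (subst card_Un_disjoint, auto)

lemma prefix_card_Vec_Diff: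
  assumes "finite I" "J \<subseteq> I"
  shows "prefix_card (Vec (I - J)) m = prefix_card (Vec I) m - prefix_card (Vec J) m"
proof -
  have "finite J" "J \<union> (I - J) = I" using assms finite_subset by auto
  then show ?thesis
    using prefix_card_Vec_Un[of J "I - J" m] assms(1) by (simp del: prefix_card.simps)
qed

lemma prefix_card_Dual: "prefix_card (Dual I) m = - prefix_card (Vec I) m"
  by simp

lemma prefix_card_le_standard:
  "I \<subseteq> {1..n} \<Longrightarrow> card I = p \<Longrightarrow> prefix_card (Vec I) m \<le> prefix_card (Vec {1..p}) m"
  using card_Int_atMost_standard[of I n m] by simp

text \<open>At \<open>m = a\<close> the inequality says that all \<open>a\<close> elements of
  \<open>I\<close> lie in [a], which determines \<open>I\<close>. Equality of weights then
  determines \<open>J\<close> through its counts.\<close>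

lemma standard_pair_unique:
  assumes "I \<subseteq> {1..n}" "J \<subseteq> {1..n}" "card I = a" "\<And>m. prefix_card (Vec {1..a}) m \<le> prefix_card (Vec I) m"
    and weight: "weight [Vec I, Dual J] = weight [Vec {1..a}, Dual {1..b}]"
  shows "I = {1..a} \<and> J = {1..b}"
proof
  have "finite I" using assms(1) finite_subset by blast
  moreover have "card I \<le> card (I \<inter> {1..a})"
    using assms(4)[of a] assms(3) by simp
  ultimately have "I \<inter> {1..a} = I" by (intro card_seteq) auto
  then show "I = {1..a}"
    using assms(3) by (intro card_subset_eq) auto
  then show "J = {1..b}"
    using fun_cong[OF weight] assms(2) by (intro prefix_card_eqI) auto
qed

text \<open>Triangles and diamonds all start from a vector and a covector. For such sources the
  uniqueness clause of \<open>leading\<close> follows from weight preservation and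
  \<open>standard_pair_unique\<close>, so only dominance and weights remain to be checked.\<close>

lemma leading_pairI:
  assumes "arity f = 2" "a \<le> n" "b \<le> n"
    and t: "weight t = weight [Vec {1..a}, Dual {1..b}]" "t \<in> keys (img f [Vec {1..a}, Dual {1..b}])"
    and step: "\<And>h I J y. I \<subseteq> {1..n} \<Longrightarrow> card I = a \<Longrightarrow> J \<subseteq> {1..n} \<Longrightarrow> card J = b \<Longrightarrow> (\<And>m. 0 \<le> h m) \<Longrightarrow>
      (\<And>m. 0 \<le> h m + prefix_card (Vec I) m - prefix_card (Vec {1..a}) m
         - prefix_card (Vec J) m + prefix_card (Vec {1..b}) m) \<Longrightarrow>
      y \<in> keys (img f [Vec I, Dual J]) \<Longrightarrow> dominates n h y t \<and> weight y = weight [Vec I, Dual J]"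
  shows "leading n f [Vec {1..a}, Dual {1..b}] t"
  unfolding leading_def
proof (intro conjI allI impI)
  let ?s = "[Vec {1..a}, Dual {1..b}]"
  fix h x y assume x: "dominates n h x ?s" and y: "y \<in> keys (img f x)"
  obtain u v where uv: "x = [u, v]"
    using dominates_length[OF x] by (auto simp: length_Suc_conv)
  obtain I J where IJ: "x = [Vec I, Dual J]"
    using x unfolding uv by (cases u; cases v) auto
  have I: "I \<subseteq> {1..n}" "card I = a" and J: "J \<subseteq> {1..n}" "card J = b"
    and h: "\<And>m. 0 \<le> h m" "\<And>m. 0 \<le> h m + prefix_card (Vec I) m - prefix_card (Vec {1..a}) m"
      "\<And>m. 0 \<le> h m + prefix_card (Vec I) m - prefix_card (Vec {1..a}) m
         - prefix_card (Vec J) m + prefix_card (Vec {1..b}) m"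
    using x unfolding IJ by auto
  note * = step[OF I J h(1,3) y[unfolded IJ]]
  then show "dominates n h y t" "weight y = weight x" by (simp_all only: IJ)
  assume "h = (\<lambda>_. 0)" "y = t"
  then have "I = {1..a} \<and> J = {1..b}"
    using h(2) * t(1) by (intro standard_pair_unique[OF I(1) J(1) I(2)]) auto
  then show "x = ?s" by (simp add: IJ)
qed (use assms(1-3) t in auto)

fun letter_factor :: "letter \<Rightarrow> factor" where
  "letter_factor (Unbarred a) = Vec {a}"
| "letter_factor (Barred a) = Dual {a}"

lemma prefix_card_singleton:
  assumes "1 \<le> a"
  shows "prefix_card (Vec {a}) m = prefix_card (Vec {1..a}) m - prefix_card (Vec {1..a - 1}) m"
proof -
  have "{a} = {1..a} - {1..a - 1}" using assms by auto
  then show ?thesis by (simp only:) (rule prefix_card_Vec_Diff, auto)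
qed

text \<open>A nonzero image is a single factor carrying the whole weight of the input. The
  inequality required after it is therefore the one known after both input factors.\<close>

lemma leading_triangle:
  assumes l: "l \<in> Unbarred ` {1..n} \<union> Barred ` {1..n}"
  shows "leading n (triangle n l) [Vec {1..left_label l}, Dual {1..right_label l}] [letter_factor l]"
proof (cases l)
  case (Unbarred a)
  with l have a: "1 \<le> a" "a \<le> n" by auto
  have eq: "{1..a} - {1..a - 1} = {a}" using a by auto
  have "leading n (triangle n (Unbarred a)) [Vec {1..a}, Dual {1..a - 1}] [Vec {a}]"
  proof (rule leading_pairI)
    show "arity (triangle n (Unbarred a)) = 2" by simp
    show "weight [Vec {a}] = weight [Vec {1..a}, Dual {1..a - 1}]"
      by (rule ext) (simp del: prefix_card.simps add: prefix_card_Dual prefix_card_singleton[OF a(1)])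
    show "[Vec {a}] \<in> keys (img (triangle n (Unbarred a)) [Vec {1..a}, Dual {1..a - 1}])"
      by (subst keys_triangle_unbarred) (use a eq in auto)
  next
    fix h I J y
    assume I: "I \<subseteq> {1..n}" "card I = a" and J: "J \<subseteq> {1..n}" "card J = a - 1" and h: "\<And>m. 0 \<le> h m"
      "\<And>m. 0 \<le> h m + prefix_card (Vec I) m - prefix_card (Vec {1..a}) m
         - prefix_card (Vec J) m + prefix_card (Vec {1..a - 1}) m"
      and y: "y \<in> keys (img (triangle n (Unbarred a)) [Vec I, Dual J])"
    have fin: "finite I" "finite J" using I(1) J(1) finite_subset by blast+
    have y': "y = [Vec (I - J)]" "J \<subseteq> I"
      using y keys_triangle_unbarred[OF fin(1) I(2) a(1) J(2), of n] by (auto split: if_splits)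
    have "card (I - J) = 1" using y' fin I J a by (simp add: card_Diff_subset)
    moreover note P = prefix_card_Vec_Diff[OF fin(1) y'(2)]
    moreover note prefix_card_singleton[OF a(1)]
    ultimately show "dominates n h y [Vec {a}] \<and> weight y = weight [Vec I, Dual J]"
      unfolding y'(1) using I(1) h
      by (auto simp only: dominates.simps same_kind.simps weight_simps prefix_card_Dual fun_eq_iff)
        (auto simp: algebra_simps)
  qed (use a in auto)
  then show ?thesis by (simp add: Unbarred)
next
  case (Barred a)
  with l have a: "1 \<le> a" "a \<le> n" by auto
  have eq: "{1..a} - {1..a - 1} = {a}" using a by auto
  have "leading n (triangle n (Barred a)) [Vec {1..a - 1}, Dual {1..a}] [Dual {a}]"
  proof (rule leading_pairI)
    show "arity (triangle n (Barred a)) = 2" by simp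
    show "weight [Dual {a}] = weight [Vec {1..a - 1}, Dual {1..a}]"
      by (rule ext) (simp del: prefix_card.simps add: prefix_card_Dual prefix_card_singleton[OF a(1)])
    show "[Dual {a}] \<in> keys (img (triangle n (Barred a)) [Vec {1..a - 1}, Dual {1..a}])"
      by (subst keys_triangle_barred) (use a eq in auto)
  next
    fix h J I y
    assume J: "J \<subseteq> {1..n}" "card J = a - 1" and I: "I \<subseteq> {1..n}" "card I = a" and h: "\<And>m. 0 \<le> h m"
      "\<And>m. 0 \<le> h m + prefix_card (Vec J) m - prefix_card (Vec {1..a - 1}) m
         - prefix_card (Vec I) m + prefix_card (Vec {1..a}) m"
      and y: "y \<in> keys (img (triangle n (Barred a)) [Vec J, Dual I])"
    have fin: "finite I" "finite J" using I(1) J(1) finite_subset by blast+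
    have y': "y = [Dual (I - J)]" "J \<subseteq> I"
      using y keys_triangle_barred[OF I a(1) J(2)] by (auto split: if_splits)
    have "card (I - J) = 1" using y' fin I J a by (simp add: card_Diff_subset)
    moreover note P = prefix_card_Vec_Diff[OF fin(1) y'(2)]
    moreover note prefix_card_singleton[OF a(1)]
    ultimately show "dominates n h y [Dual {a}] \<and> weight y = weight [Vec J, Dual I]"
      unfolding y'(1) using I(1) h
      by (auto simp only: dominates.simps same_kind.simps weight_simps prefix_card_Dual fun_eq_iff)
        (auto simp: algebra_simps)
  qed (use a in auto)
  then show ?thesis by (simp add: Barred)
qed

section \<open>Leading words of diamonds\<close>

lemma arity_diamond [simp]: "arity (diamond n x b) = 2"
  by (simp add: diamond_def Let_def)

text \<open>Coevaluation yields words of weight zero, so only the prefix of length one matters;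
  there the inequality holds because [b] has at least as large counts as any \<open>Y\<close> of
  size \<open>b\<close>. The empty sets are written \<open>{1..0}\<close> to fit
  \<open>leading_pairI\<close>.\<close>

lemma leading_diamond_eq:
  assumes "b \<le> n"
  shows "leading n (diamond n b b) [Vec {1..0}, Dual {1..0}] [Dual {1..b}, Vec {1..b}]"
proof (rule leading_pairI)
  show "[Dual {1..b}, Vec {1..b}] \<in> keys (img (diamond n b b) [Vec {1..0}, Dual {1..0}])"
    using assms by (auto simp: keys_diamond_eq subsets_def)
  show "weight [Dual {1..b}, Vec {1..b}] = weight [Vec {1..0}, Dual {1..0}]"
    by (simp add: fun_eq_iff)
next
  fix h :: "nat \<Rightarrow> int" and I J y
  assume I: "I \<subseteq> {1..n}" "card I = 0" and J: "J \<subseteq> {1..n}" "card J = 0" and h: "\<And>m. 0 \<le> h m"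
    and y: "y \<in> keys (img (diamond n b b) [Vec I, Dual J])"
  have "I = {}" "J = {}" using I J finite_subset by fastforce+
  then obtain Y where Y: "y = [Dual Y, Vec Y]" "Y \<subseteq> {1..n}" "card Y = b" "I = {}" "J = {}"
    using y by (auto simp: keys_diamond_eq subsets_def)
  have *: "0 \<le> h m - prefix_card (Vec Y) m + prefix_card (Vec {1..b}) m" for m
    using h[of m] prefix_card_le_standard[OF Y(2,3), of m] by linarith
  show "dominates n h y [Dual {1..b}, Vec {1..b}] \<and> weight y = weight [Vec I, Dual J]"
    using * h Y by (auto simp: fun_eq_iff)
qed (use assms in auto)

text \<open>After the first output factor the inequality compares \<open>Y\<close> with [x], which
  has the highest weight. After both factors it is the one known for the input, as the weight is
  preserved.\<close>

lemma leading_diamond_less: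
  assumes "x < b" "b \<le> n"
  shows "leading n (diamond n x b) [Vec {1..b}, Dual {1..x}] [Dual {1..x}, Vec {1..b}]"
proof (rule leading_pairI)
  have "{1..x} \<union> ({1..b} - {1..x}) = {1..b}" using assms by auto
  then show "[Dual {1..x}, Vec {1..b}] \<in> keys (img (diamond n x b) [Vec {1..b}, Dual {1..x}])"
    using assms by (subst keys_diamond_less) (auto simp: subsets_def image_iff intro!: exI[of _ "{1..x}"])
  show "weight [Dual {1..x}, Vec {1..b}] = weight [Vec {1..b}, Dual {1..x}]"
    by (simp add: fun_eq_iff)
next
  fix h B X y
  assume B: "B \<subseteq> {1..n}" "card B = b" and X: "X \<subseteq> {1..n}" "card X = x" and h: "\<And>m. 0 \<le> h m"
    "\<And>m. 0 \<le> h m + prefix_card (Vec B) m - prefix_card (Vec {1..b}) m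
         - prefix_card (Vec X) m + prefix_card (Vec {1..x}) m"
    and y: "y \<in> keys (img (diamond n x b) [Vec B, Dual X])"
  have fin: "finite B" "finite X" using B(1) X(1) finite_subset by blast+
  obtain Y where Y: "y = [Dual Y, Vec (Y \<union> (B - X))]" "Y \<subseteq> {1..n}" "card Y = x"
    "Y \<inter> (B - X) = {}" "X \<subseteq> B"
    using y keys_diamond_less[OF assms(1) fin(1) B(2) X(2), of n] by (auto simp: subsets_def split: if_splits)
  have finY: "finite Y" using Y(2) finite_subset by blast
  have "card (Y \<union> (B - X)) = b"
    using Y fin finY B X assms by (simp add: card_Un_disjoint card_Diff_subset)
  moreover have "Y \<union> (B - X) \<subseteq> {1..n}" using Y B by auto
  moreover have "prefix_card (Vec (Y \<union> (B - X))) m =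
      prefix_card (Vec Y) m + prefix_card (Vec B) m - prefix_card (Vec X) m" for m
    using prefix_card_Vec_Un[of Y "B - X"] prefix_card_Vec_Diff[OF fin(1) Y(5)] fin finY Y by simp
  moreover note prefix_card_le_standard[OF Y(2,3)]
  moreover have "0 \<le> h m - prefix_card (Vec Y) m + prefix_card (Vec {1..x}) m" for m
    using h(1)[of m] prefix_card_le_standard[OF Y(2,3), of m] by linarith
  ultimately show "dominates n h y [Dual {1..x}, Vec {1..b}] \<and> weight y = weight [Vec B, Dual X]"
    unfolding Y(1) using h Y(2,3)
    by (auto simp only: dominates.simps same_kind.simps weight_simps prefix_card_Dual fun_eq_iff)
      (auto simp: algebra_simps)
qed (use assms in auto)

text \<open>The two inequalities are those of the case \<open>x < b\<close>. Weight preservation now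
  comes from additivity of the counts along the nested differences \<open>Y - (X - B)\<close> and
  \<open>X - B\<close>.\<close>

lemma leading_diamond_greater:
  assumes "b < x" "x \<le> n"
  shows "leading n (diamond n x b) [Vec {1..b}, Dual {1..x}] [Dual {1..x}, Vec {1..b}]"
proof (rule leading_pairI)
  have "{1..x} - ({1..x} - {1..b}) = {1..b}" using assms by auto
  then show "[Dual {1..x}, Vec {1..b}] \<in> keys (img (diamond n x b) [Vec {1..b}, Dual {1..x}])"
    using assms by (subst keys_diamond_greater) (auto simp: subsets_def image_iff intro!: exI[of _ "{1..x}"])
  show "weight [Dual {1..x}, Vec {1..b}] = weight [Vec {1..b}, Dual {1..x}]"
    by (simp add: fun_eq_iff)
next
  fix h B X y
  assume B: "B \<subseteq> {1..n}" "card B = b" and X: "X \<subseteq> {1..n}" "card X = x" and h: "\<And>m. 0 \<le> h m"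
    "\<And>m. 0 \<le> h m + prefix_card (Vec B) m - prefix_card (Vec {1..b}) m
         - prefix_card (Vec X) m + prefix_card (Vec {1..x}) m"
    and y: "y \<in> keys (img (diamond n x b) [Vec B, Dual X])"
  have fin: "finite B" "finite X" using B(1) X(1) finite_subset by blast+
  obtain Y where Y: "y = [Dual Y, Vec (Y - (X - B))]" "Y \<subseteq> {1..n}" "card Y = x"
    "X - B \<subseteq> Y" "B \<subseteq> X"
    using y keys_diamond_greater[OF assms(1) X(1) B(2) X(2)] by (auto simp: subsets_def split: if_splits)
  have finY: "finite Y" using Y(2) finite_subset by blast
  have "card (Y - (X - B)) = b"
    using Y fin finY B X assms by (simp add: card_Diff_subset)
  moreover have "Y - (X - B) \<subseteq> {1..n}" using Y by auto
  moreover have "prefix_card (Vec (Y - (X - B))) m =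
      prefix_card (Vec Y) m - prefix_card (Vec X) m + prefix_card (Vec B) m" for m
    using prefix_card_Vec_Diff[OF finY Y(4)] prefix_card_Vec_Diff[OF fin(2) Y(5)] by simp
  moreover have "0 \<le> h m - prefix_card (Vec Y) m + prefix_card (Vec {1..x}) m" for m
    using h(1)[of m] prefix_card_le_standard[OF Y(2,3), of m] by linarith
  ultimately show "dominates n h y [Dual {1..x}, Vec {1..b}] \<and> weight y = weight [Vec B, Dual X]"
    unfolding Y(1) using h Y(2,3)
    by (auto simp only: dominates.simps same_kind.simps weight_simps prefix_card_Dual fun_eq_iff)
      (auto simp: algebra_simps)
qed (use assms in auto)

lemma leading_diamond:
  assumes "x \<le> n" "b \<le> n"
  shows "leading n (diamond n x b) [Vec {1..fst (bottom_labels x b)}, Dual {1..snd (bottom_labels x b)}]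
    [Dual {1..x}, Vec {1..b}]"
  using leading_diamond_eq[of b n] leading_diamond_less[of x b n] leading_diamond_greater[of b x n] assms
  by (cases x b rule: linorder_cases) (simp_all add: bottom_labels_def)

section \<open>The growth algorithm\<close>

lemma labels_le:
  assumes "w \<in> words n r" "1 \<le> i" "i + k \<le> r"
  shows "fst (labels w i k) \<le> n \<and> snd (labels w i k) \<le> n"
  using assms(2,3)
proof (induction k arbitrary: i)
  case 0
  then have "w ! (i - 1) \<in> set w" using assms(1) by (auto simp: words_def)
  then have "w ! (i - 1) \<in> Unbarred ` {1..n} \<union> Barred ` {1..n}"
    using assms(1) by (auto simp: words_def)
  then show ?case by auto
next
  case (Suc k)
  from Suc.IH[of i] Suc.IH[of "Suc i"] Suc.prems show ?case
    by (simp add: bottom_labels_def)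
qed

text \<open>The basis vector of \<open>W\<^sub>d\<close> in which every \<open>V(p)\<close> and \<open>V(p)\<^sup>*\<close> contributes the set \<open>[p]\<close>.\<close>

definition standard :: "letter list \<Rightarrow> nat \<Rightarrow> factor list" where
  "standard w d = map (\<lambda>j. Vec {1..L w 1 j}) [1..<d]
    @ concat (map (\<lambda>i. [Vec {1..L w i (i + d - 1)}, Dual {1..R w i (i + d - 1)}]) [1..<length w - d + 2])
    @ map (\<lambda>i. Dual {1..R w i (length w)}) [length w - d + 2..<length w + 1]"

text \<open>Diamonds produce pairs of a covector and a vector from neighbouring positions, whereas
  the next layer groups a vector with the covector of the same position. The two outer factors
  complete the regrouping.\<close>

lemma concat_pairs_shift:
  "k \<ge> 1 \<Longrightarrow> P 1 # concat (map (\<lambda>i. [Q i, P (i + 1)]) [1..<k]) @ [Q k] =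
    concat (map (\<lambda>i. [P i, Q i]) [1..<k + 1])"
proof (induction k rule: nat_induct_at_least)
  case (Suc k)
  have "concat (map (\<lambda>i. [P i, Q i]) [1..<Suc k + 1]) =
      concat (map (\<lambda>i. [P i, Q i]) [1..<k + 1]) @ [P (Suc k), Q (Suc k)]"
    using Suc.hyps by simp
  also have "\<dots> = P 1 # concat (map (\<lambda>i. [Q i, P (i + 1)]) [1..<Suc k]) @ [Q (Suc k)]"
    unfolding Suc.IH[symmetric] using Suc.hyps by simp
  finally show ?case ..
qed simp

lemma leading_layer:
  assumes w: "w \<in> words n r" and d: "1 \<le> d" "d < r"
  shows "leading n (layer n w d) (standard w (Suc d)) (standard w d)"
proof -
  have r: "length w = r" using w by (simp add: words_def)
  have LR: "L w i j \<le> n" "R w i j \<le> n" if "1 \<le> i" "i \<le> j" "j \<le> r" for i j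
    using labels_le[OF w, of i "j - i"] that by (simp_all add: L_def R_def)
  let ?k = "r - d + 1"
  let ?D = "\<lambda>i. diamond n (R w i (i + d - 1)) (L w (i + 1) (i + d))"
  let ?s = "\<lambda>i. [Vec {1..L w i (i + d)}, Dual {1..R w i (i + d)}]"
  let ?t = "\<lambda>i. [Dual {1..R w i (i + d - 1)}, Vec {1..L w (i + 1) (i + d)}]"
  define a where "a = map (\<lambda>j. Vec {1..L w 1 j}) [1..<d + 1]"
  define b where "b = map (\<lambda>i. Dual {1..R w i r}) [?k..<r + 1]"
  have ab: "length a = d" "length b = d" using d by (simp_all add: a_def b_def)
  have "leading n (idm d) a a"
    using ab by (intro leading_idm dominates_refl) (use d LR in \<open>auto simp: a_def\<close>)
  moreover have "leading n (idm d) b b"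
    using ab by (intro leading_idm dominates_refl) (use d LR in \<open>auto simp: b_def\<close>)
  moreover have "leading n (big_tens (map ?D [1..<?k])) (concat (map ?s [1..<?k])) (concat (map ?t [1..<?k]))"
  proof -
    have "leading n (?D i) (?s i) (?t i)" if "i \<in> set [1..<?k]" for i
    proof -
      have i: "1 \<le> i" "i + d \<le> r" using that d by auto
      \<comment> \<open>This is the recursive clause of \<open>labels\<close>, available since
        \<open>d\<close> is positive and hence a successor.\<close>
      have "(L w i (i + d), R w i (i + d)) = bottom_labels (R w i (i + d - 1)) (L w (i + 1) (i + d))"
        using d by (cases d) (simp_all add: L_def R_def)
      moreover have "R w i (i + d - 1) \<le> n" "L w (i + 1) (i + d) \<le> n"
        using LR i d by simp_all
      ultimately show ?thesis
        using leading_diamond[of "R w i (i + d - 1)" n "L w (i + 1) (i + d)"] by (metis fst_conv snd_conv)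
    qed
    then have "list_all2 (\<lambda>f (s, t). leading n f s t) (map ?D [1..<?k]) (map (\<lambda>i. (?s i, ?t i)) [1..<?k])"
      by (simp add: list.rel_map list_all2_same)
    from leading_big_tens[OF this] show ?thesis by (simp add: comp_def)
  qed
  ultimately have *: "leading n (layer n w d) (a @ concat (map ?s [1..<?k]) @ b) (a @ concat (map ?t [1..<?k]) @ b)"
    unfolding layer_def r by (intro leading_tens)
  have s: "a @ concat (map ?s [1..<?k]) @ b = standard w (Suc d)"
    using d by (simp add: standard_def a_def b_def r Suc_diff_Suc)
  \<comment> \<open>The last factor of \<open>a\<close> and the first factor of \<open>b\<close>
    supply the outer members of the pairs of the target, so they are split off before
    regrouping.\<close>
  let ?P = "\<lambda>i. Vec {1..L w i (i + d - 1)}" and ?Q = "\<lambda>i. Dual {1..R w i (i + d - 1)}"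
  have a: "a = map (\<lambda>j. Vec {1..L w 1 j}) [1..<d] @ [?P 1]"
    using d by (simp add: a_def)
  have "[?k..<r + 1] = ?k # [?k + 1..<r + 1]"
    by (subst upt_conv_Cons) (use d in simp_all)
  then have b: "b = ?Q ?k # map (\<lambda>i. Dual {1..R w i r}) [?k + 1..<r + 1]"
    using d by (simp add: b_def)
  have "a @ concat (map ?t [1..<?k]) @ b = map (\<lambda>j. Vec {1..L w 1 j}) [1..<d]
      @ (?P 1 # concat (map (\<lambda>i. [?Q i, ?P (i + 1)]) [1..<?k]) @ [?Q ?k])
      @ map (\<lambda>i. Dual {1..R w i r}) [?k + 1..<r + 1]"
    by (simp add: a b)
  also have "\<dots> = standard w d"
    unfolding concat_pairs_shift[of ?k ?P ?Q, OF le_add2] by (simp add: standard_def r)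
  finally show ?thesis using * s by simp
qed

text \<open>For \<open>d = 1\<close> both edge blocks of \<open>standard\<close> are empty, and its
  pairs carry the labels of the individual triangles.\<close>

lemma leading_triangles:
  assumes w: "w \<in> words n r" "w \<noteq> []"
  shows "leading n (big_tens (map (triangle n) w)) (standard w 1) (map letter_factor w)"
proof -
  let ?s = "\<lambda>l. [Vec {1..left_label l}, Dual {1..right_label l}]"
  have tri: "leading n (triangle n l) (?s l) [letter_factor l]" if "l \<in> set w" for l
    by (rule leading_triangle) (use that w in \<open>auto simp: words_def\<close>)
  have "list_all2 (\<lambda>f (s, t). leading n f s t) (map (triangle n) w) (map (\<lambda>l. (?s l, [letter_factor l])) w)"
    using tri by (simp add: list.rel_map list_all2_same)
  from leading_big_tens[OF this]
  have *: "leading n (big_tens (map (triangle n) w)) (concat (map ?s w)) (map letter_factor w)"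
    by (simp add: comp_def)
  have "standard w 1 = concat (map (\<lambda>i. ?s (w ! (i - 1))) [1..<length w + 1])"
    using w(2) by (cases w) (simp_all add: standard_def L_def R_def)
  also have "[1..<length w + 1] = map Suc [0..<length w]"
    by (simp add: map_Suc_upt)
  also have "concat (map (\<lambda>i. ?s (w ! (i - 1))) (map Suc [0..<length w])) = concat (map ?s (map ((!) w) [0..<length w]))"
    by (simp add: comp_def)
  finally show ?thesis using * by (simp add: map_nth)
qed

lemma foldr_comp_apply: "foldr (\<circ>) fs g v = foldr (\<circ>) fs id (g v)"
  by (induction fs) auto

text \<open>The layer of largest index acts first. The induction peels it off and continues with its
  output, whence the arbitrary \<open>v\<close>.\<close>

lemma led_by_layers:
  assumes "w \<in> words n r" "1 \<le> m" "m \<le> r" "led_by n v (standard w m)"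
  shows "led_by n (foldr (\<circ>) (map (\<lambda>d. app (layer n w d)) [1..<m]) id v) (standard w 1)"
  using assms(2-)
proof (induction m arbitrary: v rule: nat_induct_at_least)
  case (Suc m)
  have "led_by n (app (layer n w m) v) (standard w m)"
    using Suc by (intro led_by_app[OF leading_layer[OF assms(1)]]) auto
  then have "led_by n (foldr (\<circ>) (map (\<lambda>d. app (layer n w d)) [1..<m]) id (app (layer n w m) v)) (standard w 1)"
    using Suc.prems by (intro Suc.IH) auto
  moreover have "foldr (\<circ>) (map (\<lambda>d. app (layer n w d)) [1..<Suc m]) id =
      foldr (\<circ>) (map (\<lambda>d. app (layer n w d)) [1..<m]) (app (layer n w m))"
    using Suc.hyps by simp
  ultimately show ?case
    by (simp only: foldr_comp_apply[where g = "app (layer n w m)"])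
qed simp

lemma led_by_A:
  assumes "w \<in> words n r"
  shows "led_by n (A n w) (map letter_factor w)"
proof (cases "w = []")
  case True
  then show ?thesis by (simp add: A_def led_by_basis)
next
  case False
  have r: "length w = r" using assms by (simp add: words_def)
  then have pos: "r \<ge> 1" using False by (cases w) auto
  have LR: "L w i j \<le> n" "R w i j \<le> n" if "1 \<le> i" "i \<le> j" "j \<le> r" for i j
    using labels_le[OF assms, of i "j - i"] that by (simp_all add: L_def R_def)
  \<comment> \<open>For \<open>d = r\<close> a single pair is left in \<open>standard\<close>; it
    consists of the last left edge factor and the first right edge factor, so the input of the flow
    is \<open>standard w r\<close>.\<close>
  have "map (\<lambda>j. Vec {1..L w 1 j}) [1..<r + 1] = map (\<lambda>j. Vec {1..L w 1 j}) [1..<r] @ [Vec {1..L w 1 r}]"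
    using pos by simp
  moreover have "map (\<lambda>i. Dual {1..R w i r}) [1..<r + 1] = Dual {1..R w 1 r} # map (\<lambda>i. Dual {1..R w i r}) [2..<r + 1]"
    using pos by (simp add: upt_conv_Cons numeral_2_eq_2 del: upt_Suc)
  moreover have "standard w r = map (\<lambda>j. Vec {1..L w 1 j}) [1..<r] @
      [Vec {1..L w 1 r}, Dual {1..R w 1 r}] @ map (\<lambda>i. Dual {1..R w i r}) [2..<r + 1]"
    by (simp add: standard_def r numeral_2_eq_2)
  ultimately have start: "map (\<lambda>j. Vec {1..L w 1 j}) [1..<r + 1] @ map (\<lambda>i. Dual {1..R w i r}) [1..<r + 1] = standard w r"
    by (simp only: append.simps append_assoc)
  have "led_by n (basis (standard w r)) (standard w r)"
    unfolding start[symmetric]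
    by (intro led_by_basis dominates_refl) (use LR in auto)
  from led_by_app[OF leading_triangles[OF assms False] led_by_layers[OF assms pos order.refl this]]
  have "led_by n (flow n w (basis (standard w r))) (map letter_factor w)"
    by (simp add: flow_def r)
  moreover have "A n w = flow n w (basis (standard w r))"
    using False by (simp only: A_def if_False r start)
  ultimately show ?thesis by simp
qed

section \<open>Triangular families\<close>

lemma span_basis_image: "tens.span (basis ` U) = {x. keys x \<subseteq> U}"
proof
  have "tens.subspace {x. keys x \<subseteq> U}"
    by (auto simp: tens.subspace_def keys_scale dest: subsetD[OF keys_add])
  then show "tens.span (basis ` U) \<subseteq> {x. keys x \<subseteq> U}"
    by (intro tens.span_minimal) auto
  show "{x. keys x \<subseteq> U} \<subseteq> tens.span (basis ` U)"
  proof
    fix x :: tens assume x: "x \<in> {x. keys x \<subseteq> U}"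
    have "x = (\<Sum>u\<in>keys x. scale (lookup x u) (basis u))"
      by (rule poly_mapping_eqI) (simp add: lookup_sum lookup_scale lookup_basis in_keys_iff if_distrib cong: if_cong)
    also have "\<dots> \<in> tens.span (basis ` U)"
      using x by (intro tens.span_sum tens.span_scale tens.span_base) auto
    finally show "x \<in> tens.span (basis ` U)" .
  qed
qed

lemma inj_basis: "inj basis"
  by (metis injI keys_basis singleton_inject)

lemma independent_basis_image: "tens.independent (basis ` U)"
  unfolding tens.dependent_def
proof safe
  fix u assume "basis u \<in> tens.span (basis ` U - {basis u})"
  also have "basis ` U - {basis u} = basis ` (U - {u})"
    using inj_basis by (auto dest: injD)
  finally show False by (simp add: span_basis_image)
qed

lemma triangular_family_basis:
  assumes fin: "finite W" and inj: "inj_on l W"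
    and led: "\<And>w. w \<in> W \<Longrightarrow> led_by n (v w) (l w)"
    and closed: "\<And>w x. w \<in> W \<Longrightarrow> dominates n (\<lambda>_. 0) x (l w) \<Longrightarrow> x \<in> l ` W"
  shows "inj_on v W \<and> tens.independent (v ` W) \<and> tens.span (v ` W) = tens.span (basis ` l ` W)"
proof -
  let ?U = "l ` W"
  have finU: "finite ?U" using fin by simp
  have card_U: "card (basis ` ?U) = card W"
    using inj inj_basis by (simp add: card_image inj_on_subset)
  have v: "keys (v w) \<subseteq> ?U" if "w \<in> W" for w
    using led[OF that] closed[OF that] by (auto simp: led_by_def)
  have basis_in: "basis u \<in> tens.span (v ` W)" if "u \<in> ?U" for u
    using that
  \<comment> \<open>Any other word in the support of the family member led by \<open>u\<close>
    strictly dominates \<open>u\<close>, so fewer words dominate it and the induction hypothesis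
    applies.\<close>
  proof (induction "card {x \<in> ?U. dominates n (\<lambda>_. 0) x u}" arbitrary: u rule: less_induct)
    case less
    then obtain w where w: "w \<in> W" "u = l w" by blast
    define c where "c = lookup (v w) u"
    have u: "u \<in> keys (v w)" and dom: "\<And>x. x \<in> keys (v w) \<Longrightarrow> dominates n (\<lambda>_. 0) x u"
      using led[OF w(1)] w(2) by (auto simp: led_by_def)
    have c: "c \<noteq> 0" using u by (simp add: c_def in_keys_iff)
    have rest: "basis x \<in> tens.span (v ` W)" if x: "x \<in> keys (v w) - {u}" for x
    proof (rule less.hyps)
      show "x \<in> ?U" using v[OF w(1)] x by auto
      have xu: "dominates n (\<lambda>_. 0) x u" "\<not> dominates n (\<lambda>_. 0) u x"
        using dom[of x] dominates_antisym[of n x u] x by auto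
      have "{y \<in> ?U. dominates n (\<lambda>_. 0) y x} \<subset> {y \<in> ?U. dominates n (\<lambda>_. 0) y u}"
        using xu dominates_trans[of n _ x u] dom[OF u] less.prems by blast
      then show "card {y \<in> ?U. dominates n (\<lambda>_. 0) y x} < card {y \<in> ?U. dominates n (\<lambda>_. 0) y u}"
        using finU by (intro psubset_card_mono) auto
    qed
    \<comment> \<open>Removing the leading term leaves a combination of words already known to lie
      in the span; since \<open>c\<close> is nonzero, \<open>basis u\<close> can be solved
      for.\<close>
    have "v w - scale c (basis u) \<in> tens.span (basis ` (keys (v w) - {u}))"
      unfolding span_basis_image
      by (auto simp: in_keys_iff lookup_minus lookup_scale lookup_basis c_def split: if_splits)
    also have "\<dots> \<subseteq> tens.span (v ` W)"
      using rest by (intro tens.span_minimal tens.subspace_span) auto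
    finally have "v w - (v w - scale c (basis u)) \<in> tens.span (v ` W)"
      by (rule tens.span_diff[OF tens.span_base[OF imageI[OF w(1)]]])
    then have "scale c (basis u) \<in> tens.span (v ` W)"
      by simp
    from tens.span_scale[OF this, of "inverse c"] show ?case
      by (simp only: tens.scale_scale left_inverse[OF c] tens.scale_one)
  qed
  have span: "tens.span (v ` W) = tens.span (basis ` ?U)"
  proof
    show "tens.span (v ` W) \<subseteq> tens.span (basis ` ?U)"
      using v by (intro tens.span_minimal tens.subspace_span) (auto simp: span_basis_image)
    show "tens.span (basis ` ?U) \<subseteq> tens.span (v ` W)"
      using basis_in by (intro tens.span_minimal tens.subspace_span) auto
  qed
  \<comment> \<open>Steinitz bound against the independent family \<open>basis\<close>
    ?U\<open>. With\<close>v \<open>W\<close> it yields injectivity, and with one vector deleted it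
    yields independence.\<close>
  have card_le: "card W \<le> card B" if "finite B" "tens.span (v ` W) \<subseteq> tens.span B" for B
    using tens.independent_span_bound[OF that(1) independent_basis_image, of ?U] that(2)
      tens.span_superset[of "basis ` ?U"] card_U by (auto simp: span)
  have inj_v: "inj_on v W"
    using card_le[of "v ` W"] fin by (intro eq_card_imp_inj_on order.antisym card_image_le) auto
  moreover have "tens.independent (v ` W)"
    unfolding tens.dependent_def
  proof safe
    fix w assume w: "w \<in> W" "v w \<in> tens.span (v ` W - {v w})"
    then have "v ` W \<subseteq> tens.span (v ` W - {v w})"
      using tens.span_superset[of "v ` W - {v w}"] by auto
    then have "card W \<le> card (v ` W - {v w})"
      using fin by (intro card_le tens.span_minimal tens.subspace_span) auto
    also have "\<dots> < card (v ` W)"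
      using fin w(1) by (intro psubset_card_mono) auto
    also have "\<dots> \<le> card W" using fin by (rule card_image_le)
    finally show False by simp
  qed
  ultimately show ?thesis using span by simp
qed

section \<open>The basis theorem\<close>

lemma finite_words: "finite (words n r)"
proof -
  have "words n r = {w. set w \<subseteq> Unbarred ` {1..n} \<union> Barred ` {1..n} \<and> length w = r}"
    by (auto simp: words_def)
  then show ?thesis by (simp add: finite_lists_length_eq)
qed

lemma inj_letter_factor: "inj letter_factor"
proof (rule injI)
  show "k = l" if "letter_factor k = letter_factor l" for k l
    using that by (cases k; cases l) auto
qed

lemma map_letter_factor_words:
  "map letter_factor ` words n r = {u. length u = r \<and>
     set u \<subseteq> (\<lambda>i. Vec {i}) ` {1..n} \<union> (\<lambda>i. Dual {i}) ` {1..n}}" (is "_ = {u. length u = r \<and> set u \<subseteq> ?S}")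
proof -
  let ?T = "Unbarred ` {1..n} \<union> Barred ` {1..n}"
  have "map letter_factor ` words n r = map letter_factor ` {w \<in> lists ?T. length w = r}"
    unfolding words_def lists_eq_set by (rule arg_cong[where f = "image _"]) blast
  also have "\<dots> = {u \<in> map letter_factor ` lists ?T. length u = r}"
    by auto
  also have "map letter_factor ` lists ?T = lists (letter_factor ` ?T)"
    by (rule lists_image[symmetric])
  also have "letter_factor ` ?T = ?S"
    by (simp add: image_Un image_image)
  finally show ?thesis
    unfolding lists_eq_set by blast
qed

text \<open>Dominance fixes the kind and the size of every factor, so a dominating word again
  consists of singletons in \<open>{1..n}\<close>. This supplies the hypothesis
  \<open>closed\<close> of \<open>triangular_family_basis\<close>.\<close>

lemma dominates_letter_factors:
  assumes "dominates n h x (map letter_factor w)"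
  shows "length x = length w \<and> set x \<subseteq> (\<lambda>i. Vec {i}) ` {1..n} \<union> (\<lambda>i. Dual {i}) ` {1..n}"
  using assms
proof (induction w arbitrary: h x)
  case Nil
  then show ?case by (cases x) auto
next
  case (Cons k w)
  then obtain a y where "x = a # y" by (cases x) auto
  with Cons show ?case
    by (cases k; cases a) (auto simp: card_1_singleton_iff)
qed

theorem theorem4p5:
  fixes n r :: nat
  assumes "n \<ge> 1"
  shows "inj_on (A n) (words n r)
    \<and> tens.independent (A n ` words n r)
    \<and> tens.span (A n ` words n r) = tensor_power n r"
  unfolding tensor_power_def map_letter_factor_words[symmetric]
proof (rule triangular_family_basis[OF finite_words _ led_by_A])
  show "inj_on (map letter_factor) (words n r)"
    using inj_letter_factor by (intro inj_onI) (simp add: inj_map_eq_map)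
  show "x \<in> map letter_factor ` words n r"
    if "w \<in> words n r" "dominates n (\<lambda>_. 0) x (map letter_factor w)" for w x
    using dominates_letter_factors[OF that(2)] that(1)
    unfolding map_letter_factor_words by (simp add: words_def)
qed

end
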